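(* Let $X=\{x_k\}_{k\in\mathbb{Z}}\subseteq\mathbb{R}$ be a sampling set for $PW_1(\mathbb{R})$. Let $\mathcal{T}_{1,X}:R_{1,X}\to PW_1(\mathbb{R})$ be a left-inverse of $\mathcal{M}_{1,X}$, that is, $\mathcal{T}_{1,X}\mathcal{M}_{1,X}=\mathrm{id}_{PW_1(\mathbb{R})}$. Then $\mathcal{T}_{1,X}$ is (uniformly) continuous with respect to the Euclidean metric if and only if $\Delta_X>0$. If $\mathcal{M}_{1,X}$ is restricted to $$PW_1(\mathbb{R},\mathbb{R})=\{f\in PW_1(\mathbb{R}): f\text{ real-valued a.e.}\},$$ then the (uniform) continuity, with respect to the Euclidean metric, of the left inverse of the restricted operator (defined on its range $\mathcal{M}_{1,X}(PW_1(\mathbb{R},\mathbb{R}))$) is equivalent to $\Delta_{X,\mathbb{R}}>0$.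
   Context: Fourier transform: $\hat f(\xi)=\int_{\mathbb{R}}f(t)e^{-2\pi i t\xi}\,dt$. $PW_1(\mathbb{R})=\{f\in L^2(\mathbb{R}):\hat f=0\text{ a.e. outside }[-1/2,1/2]\}$ with the $L^2(\mathbb{R})$-norm; its (complex-valued) elements are identified with their continuous representatives. An enumerated set $X=\{x_k:k\in\mathbb{Z}\}\subseteq\mathbb{R}$ is a sampling set for $PW_1(\mathbb{R})$ if there are constants $0<A\le B<\infty$ with $A\|f\|_{L^2(\mathbb{R})}^2\le\sum_{k\in\mathbb{Z}}|f(x_k)|^2\le B\|f\|_{L^2(\mathbb{R})}^2$ for all $f\in PW_1(\mathbb{R})$. The sampling operator is $C_X:PW_1(\mathbb{R})\to\ell^2(\mathbb{Z})$, $C_Xf=(f(x_k))_{k\in\mathbb{Z}}$; its range $R_X$ is a closed subspace of $\ell^2(\mathbb{Z})$, and $P_X$ denotes the orthogonal projection of $\ell^2(\mathbb{Z})$ onto $R_X$. Folding with $\lambda=1$: for real $x$, $\mathcal{M}_1(x)$ is the unique number in $[-1,1)$ with $x-\mathcal{M}_1(x)\in2\mathbb{Z}$; $\mathcal{M}_1(x+iy)=\mathcal{M}_1(x)+i\mathcal{M}_1(y)$. The folded sampling operator is $\mathcal{M}_{1,X}f=(\mathcal{M}_1f(x_k))_{k\in\mathbb{Z}}$, $f\in PW_1(\mathbb{R})$, and its range is $R_{1,X}=\mathcal{M}_{1,X}(PW_1(\mathbb{R}))\subseteq\ell^2(\mathbb{Z})$. "With respect to the Euclidean metric" means that the range carries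 the metric inherited from $\ell^2(\mathbb{Z})$, while $PW_1(\mathbb{R})$ carries the $L^2(\mathbb{R})$-norm. Let $\ell^2(\mathbb{Z},\mathbb{Z}[i])$ and $\ell^2(\mathbb{Z},\mathbb{Z})$ be the sets of $n\in\ell^2(\mathbb{Z})$ with all entries in $\mathbb{Z}[i]=\mathbb{Z}+i\mathbb{Z}$, respectively in $\mathbb{Z}$. Then $$\Delta_X=\inf_{n\in\ell^2(\mathbb{Z},\mathbb{Z}[i]),\,n\ne0}\|n-P_Xn\|_{\ell^2(\mathbb{Z})},\qquad \Delta_{X,\mathbb{R}}=\inf_{n\in\ell^2(\mathbb{Z},\mathbb{Z}),\,n\neq0}\|n-P_Xn\|_{\ell^2(\mathbb{Z})}.$$ *)

theory Defs
  imports "HOL-Analysis.Analysis"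
begin

section \<open>Square integrable functions and the Fourier transform\<close>

definition square_integrable :: "(real \<Rightarrow> complex) \<Rightarrow> bool" where
  "square_integrable f \<longleftrightarrow>
     f \<in> borel_measurable lborel \<and> integrable lborel (\<lambda>t. (cmod (f t))\<^sup>2)"

definition L2_norm :: "(real \<Rightarrow> complex) \<Rightarrow> real" where
  "L2_norm f = sqrt (LINT t|lborel. (cmod (f t))\<^sup>2)"

text \<open>The Fourier integral, meaningful for integrable \<open>f\<close>.\<close>

definition fourier_integral :: "(real \<Rightarrow> complex) \<Rightarrow> real \<Rightarrow> complex" where
  "fourier_integral f \<xi> =
     (LINT t|lborel. f t * exp (- (2 * complex_of_real pi * \<i> * complex_of_real t * complex_of_real \<xi>)))"

text \<open>
  \<open>g\<close> is (a representative of) the Fourier transform of the square integrable function \<open>f\<close>.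
  A square integrable function need not be integrable, so its transform is the \<open>L\<^sup>2\<close>-limit of
  the Fourier integrals over \<open>[-N, N]\<close>. Convergence is expressed by a nonnegative
  integral, which unlike the Bochner integral is not zero for non-integrable functions.
\<close>

definition has_fourier_transform :: "(real \<Rightarrow> complex) \<Rightarrow> (real \<Rightarrow> complex) \<Rightarrow> bool" where
  "has_fourier_transform f g \<longleftrightarrow>
     square_integrable f \<and> square_integrable g \<and>
     (\<lambda>N::nat. \<integral>\<^sup>+ \<xi>. ennreal ((cmod (fourier_integral
           (\<lambda>t. if t \<in> {- real N..real N} then f t else 0) \<xi> - g \<xi>))\<^sup>2) \<partial>lborel)
       \<longlonglongrightarrow> 0"


section \<open>The Paley-Wiener space\<close>

text \<open>
  Elements of \<open>L\<^sup>2\<close> are classes of functions; membership of a class in the Paley-Wiener space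
  gives it a unique continuous representative, and the set below consists of these representatives.
  The transform is determined up to null sets, so it does not matter which one is taken.
\<close>

definition PW :: "(real \<Rightarrow> complex) set" where
  "PW = {f. continuous_on UNIV f \<and> square_integrable f \<and>
            (\<exists>g. has_fourier_transform f g \<and> (AE \<xi> in lborel. \<xi> \<notin> {-1/2..1/2} \<longrightarrow> g \<xi> = 0))}"

definition PW_real :: "(real \<Rightarrow> complex) set" where
  "PW_real = {f \<in> PW. AE t in lborel. f t \<in> \<real>}"

definition PW_metric :: "(real \<Rightarrow> complex) metric" where
  "PW_metric = metric (PW, \<lambda>f g. L2_norm (\<lambda>t. f t - g t))"


section \<open>Square summable sequences\<close>

definition ell2 :: "(int \<Rightarrow> complex) set" where
  "ell2 = {a. (\<lambda>k. (cmod (a k))\<^sup>2) summable_on UNIV}"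

definition ell2_norm :: "(int \<Rightarrow> complex) \<Rightarrow> real" where
  "ell2_norm a = sqrt (\<Sum>\<^sub>\<infinity>k. (cmod (a k))\<^sup>2)"

definition ell2_inner :: "(int \<Rightarrow> complex) \<Rightarrow> (int \<Rightarrow> complex) \<Rightarrow> complex" where
  "ell2_inner a b = (\<Sum>\<^sub>\<infinity>k. a k * cnj (b k))"

definition ell2_metric :: "(int \<Rightarrow> complex) metric" where
  "ell2_metric = metric (ell2, \<lambda>a b. ell2_norm (\<lambda>k. a k - b k))"

text \<open>Orthogonal projection onto \<open>R\<close>, meaningful if \<open>R\<close> is a closed subspace of \<^const>\<open>ell2\<close>
  and \<open>a\<close> belongs to \<^const>\<open>ell2\<close>.\<close>

definition orth_proj :: "(int \<Rightarrow> complex) set \<Rightarrow> (int \<Rightarrow> complex) \<Rightarrow> int \<Rightarrow> complex" where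
  "orth_proj R a = (THE p. p \<in> R \<and> (\<forall>r\<in>R. ell2_inner (\<lambda>k. a k - p k) r = 0))"


section \<open>Sampling and folding\<close>

definition sample :: "(int \<Rightarrow> real) \<Rightarrow> (real \<Rightarrow> complex) \<Rightarrow> int \<Rightarrow> complex" where
  "sample x f = (\<lambda>k. f (x k))"

definition sampling_set :: "(int \<Rightarrow> real) \<Rightarrow> bool" where
  "sampling_set x \<longleftrightarrow>
     (\<exists>A B. 0 < A \<and> A \<le> B \<and>
        (\<forall>f\<in>PW. sample x f \<in> ell2 \<and>
                A * (L2_norm f)\<^sup>2 \<le> (\<Sum>\<^sub>\<infinity>k. (cmod (f (x k)))\<^sup>2) \<and>
                (\<Sum>\<^sub>\<infinity>k. (cmod (f (x k)))\<^sup>2) \<le> B * (L2_norm f)\<^sup>2))"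

definition fold_real :: "real \<Rightarrow> real" where
  "fold_real s = (THE r. r \<in> {-1..<1} \<and> (\<exists>m::int. s - r = 2 * of_int m))"

definition fold_complex :: "complex \<Rightarrow> complex" where
  "fold_complex z = Complex (fold_real (Re z)) (fold_real (Im z))"

definition folded_sample :: "(int \<Rightarrow> real) \<Rightarrow> (real \<Rightarrow> complex) \<Rightarrow> int \<Rightarrow> complex" where
  "folded_sample x f = (\<lambda>k. fold_complex (f (x k)))"

definition folded_range_metric ::
    "(int \<Rightarrow> real) \<Rightarrow> (real \<Rightarrow> complex) set \<Rightarrow> (int \<Rightarrow> complex) metric" where
  "folded_range_metric x V = submetric ell2_metric (folded_sample x ` V)"

definition proj_sample :: "(int \<Rightarrow> real) \<Rightarrow> (int \<Rightarrow> complex) \<Rightarrow> int \<Rightarrow> complex" where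
  "proj_sample x = orth_proj (sample x ` PW)"

definition ell2_gauss_int :: "(int \<Rightarrow> complex) set" where
  "ell2_gauss_int = {n \<in> ell2. \<forall>k. Re (n k) \<in> \<int> \<and> Im (n k) \<in> \<int>}"

definition ell2_int :: "(int \<Rightarrow> complex) set" where
  "ell2_int = {n \<in> ell2. \<forall>k. n k \<in> \<int>}"

definition Delta :: "(int \<Rightarrow> real) \<Rightarrow> real" where
  "Delta x = (INF n \<in> ell2_gauss_int - {\<lambda>k. 0}. ell2_norm (\<lambda>k. n k - proj_sample x n k))"

definition Delta_real :: "(int \<Rightarrow> real) \<Rightarrow> real" where
  "Delta_real x = (INF n \<in> ell2_int - {\<lambda>k. 0}. ell2_norm (\<lambda>k. n k - proj_sample x n k))"


section \<open>Well-definedness\<close>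

lemma folded_in_interval: "s - 2 * of_int \<lfloor>(s + 1) / 2\<rfloor> \<in> {-1..<1::real}"
proof -
  have "of_int \<lfloor>(s + 1) / 2\<rfloor> \<le> (s + 1) / 2" "(s + 1) / 2 < of_int \<lfloor>(s + 1) / 2\<rfloor> + 1"
    by linarith+
  then have "-1 \<le> s - 2 * of_int \<lfloor>(s + 1) / 2\<rfloor>" "s - 2 * of_int \<lfloor>(s + 1) / 2\<rfloor> < 1"
    by (simp_all add: field_simps)
  then show ?thesis by simp
qed

lemma fold_real_eq: "fold_real s = s - 2 * of_int \<lfloor>(s + 1) / 2\<rfloor>"
  unfolding fold_real_def
proof (rule the_equality)
  show "s - 2 * of_int \<lfloor>(s + 1) / 2\<rfloor> \<in> {-1..<1} \<and>
        (\<exists>m::int. s - (s - 2 * of_int \<lfloor>(s + 1) / 2\<rfloor>) = 2 * of_int m)"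
    using folded_in_interval by auto
next
  fix r assume r: "r \<in> {-1..<1} \<and> (\<exists>m::int. s - r = 2 * of_int m)"
  then obtain m :: int where m: "s - r = 2 * of_int m" by blast
  have "\<lfloor>(s + 1) / 2\<rfloor> = m"
    using r m by (intro floor_unique) auto
  then show "r = s - 2 * of_int \<lfloor>(s + 1) / 2\<rfloor>" using m by simp
qed

lemma abs_fold_real_le: "\<bar>fold_real s\<bar> \<le> \<bar>s\<bar>"
proof -
  have r: "fold_real s \<in> {-1..<1}" unfolding fold_real_eq by (rule folded_in_interval)
  show ?thesis
  proof (cases "s \<in> {-1..<1}")
    case True
    then have "\<lfloor>(s + 1) / 2\<rfloor> = 0" by (intro floor_unique) auto
    then show ?thesis by (simp add: fold_real_eq)
  next
    case False
    then show ?thesis using r by auto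
  qed
qed

lemma cmod_fold_complex_le: "cmod (fold_complex z) \<le> cmod z"
  using abs_fold_real_le[of "Re z"] abs_fold_real_le[of "Im z"]
  by (auto simp: fold_complex_def cmod_def abs_le_square_iff intro!: add_mono)

lemma folded_sample_in_ell2:
  assumes "sample x f \<in> ell2"
  shows "folded_sample x f \<in> ell2"
proof -
  have "(\<lambda>k. (cmod (f (x k)))\<^sup>2) summable_on UNIV"
    using assms by (simp add: ell2_def sample_def)
  then have "(\<lambda>k. (cmod (fold_complex (f (x k))))\<^sup>2) summable_on UNIV"
    by (rule summable_on_comparison_test) (auto intro: power_mono cmod_fold_complex_le)
  then show ?thesis by (simp add: ell2_def folded_sample_def)
qed

lemma norm_add_sq_le:
  fixes u v :: complex
  assumes "t > 0"
  shows "(cmod (u + v))\<^sup>2 \<le> (1 + t) * (cmod u)\<^sup>2 + (1 + 1 / t) * (cmod v)\<^sup>2"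
proof -
  have "(cmod (u + v))\<^sup>2 \<le> (cmod u + cmod v)\<^sup>2"
    by (intro power_mono norm_triangle_ineq) simp
  also have "\<dots> \<le> (1 + t) * (cmod u)\<^sup>2 + (1 + 1 / t) * (cmod v)\<^sup>2"
  proof -
    have "0 \<le> (t * cmod u - cmod v)\<^sup>2 / t" using assms by simp
    also have "\<dots> = t * (cmod u)\<^sup>2 - 2 * cmod u * cmod v + (cmod v)\<^sup>2 / t"
      using assms by (simp add: power2_eq_square field_simps)
    finally show ?thesis by (simp add: power2_eq_square algebra_simps)
  qed
  finally show ?thesis .
qed

lemma sqrt_le_sum_sqrt:
  fixes S a b :: real
  assumes ab: "a \<ge> 0" "b \<ge> 0"
    and le: "\<And>t. t > 0 \<Longrightarrow> S \<le> (1 + t) * a + (1 + 1 / t) * b"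
  shows "sqrt S \<le> sqrt a + sqrt b"
proof -
  consider "a > 0" "b > 0" | "a = 0" | "b = 0" using ab by linarith
  then have "S \<le> (sqrt a + sqrt b)\<^sup>2"
  proof cases
    case 1
    then have p: "sqrt a > 0" "sqrt b > 0" by auto
    have "S \<le> (1 + sqrt b / sqrt a) * (sqrt a)\<^sup>2 + (1 + 1 / (sqrt b / sqrt a)) * (sqrt b)\<^sup>2"
      using le[of "sqrt b / sqrt a"] 1 by simp
    also have "\<dots> = (sqrt a + sqrt b)\<^sup>2"
      using p by (simp add: power2_eq_square field_simps)
    finally show ?thesis .
  next
    case 2
    have "S \<le> b + e" if "e > 0" for e
    proof -
      have "b / ((b + 1) / e) \<le> e" using that ab by (simp add: field_simps)
      then show ?thesis using le[of "(b + 1) / e"] that ab 2 by (simp add: algebra_simps)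
    qed
    then show ?thesis using 2 ab field_le_epsilon by auto
  next
    case 3
    have "S \<le> a + e" if "e > 0" for e
    proof -
      have "e / (a + 1) * a \<le> e" using that ab by (simp add: field_simps)
      then show ?thesis using le[of "e / (a + 1)"] that ab 3 by (simp add: algebra_simps)
    qed
    then show ?thesis using 3 ab field_le_epsilon by auto
  qed
  then show ?thesis using ab by (simp add: real_le_lsqrt)
qed

lemma square_integrable_add:
  assumes f: "square_integrable f" and g: "square_integrable g"
  shows "square_integrable (\<lambda>t. f t + g t)"
    and "L2_norm (\<lambda>t. f t + g t) \<le> L2_norm f + L2_norm g"
proof -
  have [measurable]: "f \<in> borel_measurable lborel" "g \<in> borel_measurable lborel"
    and i: "integrable lborel (\<lambda>t. (cmod (f t))\<^sup>2)" "integrable lborel (\<lambda>t. (cmod (g t))\<^sup>2)"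
    using f g by (auto simp: square_integrable_def)
  have *: "integrable lborel (\<lambda>t. (1 + s) * (cmod (f t))\<^sup>2 + (1 + 1 / s) * (cmod (g t))\<^sup>2)" for s
    using i by auto
  have j: "integrable lborel (\<lambda>t. (cmod (f t + g t))\<^sup>2)"
    by (rule Bochner_Integration.integrable_bound[OF *[of 1]])
      (use norm_add_sq_le[of 1] in \<open>auto intro: order_trans[OF _ abs_ge_self]\<close>)
  then show "square_integrable (\<lambda>t. f t + g t)" by (simp add: square_integrable_def)
  show "L2_norm (\<lambda>t. f t + g t) \<le> L2_norm f + L2_norm g"
    unfolding L2_norm_def
  proof (rule sqrt_le_sum_sqrt)
    fix s :: real assume s: "s > 0"
    have "(LINT t|lborel. (cmod (f t + g t))\<^sup>2) \<le>
          (LINT t|lborel. (1 + s) * (cmod (f t))\<^sup>2 + (1 + 1 / s) * (cmod (g t))\<^sup>2)"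
      by (intro integral_mono j * norm_add_sq_le s)
    then show "(LINT t|lborel. (cmod (f t + g t))\<^sup>2) \<le>
          (1 + s) * (LINT t|lborel. (cmod (f t))\<^sup>2) + (1 + 1 / s) * (LINT t|lborel. (cmod (g t))\<^sup>2)"
      using i by simp
  qed auto
qed

lemma square_integrable_uminus:
  "square_integrable f \<Longrightarrow> square_integrable (\<lambda>t. - f t)"
  by (simp add: square_integrable_def)

lemma square_integrable_diff:
  assumes "square_integrable f" "square_integrable g"
  shows "square_integrable (\<lambda>t. f t - g t)"
  using square_integrable_add(1)[OF assms(1) square_integrable_uminus[OF assms(2)]] by simp

lemma L2_norm_eq_0_continuous:
  assumes "square_integrable f" "continuous_on UNIV f" "L2_norm f = 0"
  shows "f t = 0"
proof -
  have "AE t in lborel. (cmod (f t))\<^sup>2 = 0"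
    using assms by (subst integral_nonneg_eq_0_iff_AE[symmetric])
      (auto simp: square_integrable_def L2_norm_def)
  then have ae: "AE t in lebesgue. f t = 0"
    by (intro AE_completion) auto
  have op: "open {t. f t \<noteq> 0}"
    by (intro open_Collect_neq assms(2) continuous_on_const)
  have "{t. f t \<noteq> 0} \<in> null_sets lebesgue"
    using AE_iff_null_sets[of "{t. f t \<noteq> 0}" lebesgue] ae op by auto
  then have "{t. f t \<noteq> 0} = {}"
    using open_not_negligible[OF op] by (auto simp: negligible_iff_null_sets)
  then show ?thesis by auto
qed

lemma Metric_space_PW: "Metric_space PW (\<lambda>f g. L2_norm (\<lambda>t. f t - g t))"
proof
  fix f g :: "real \<Rightarrow> complex"
  show "0 \<le> L2_norm (\<lambda>t. f t - g t)" by (simp add: L2_norm_def)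
  show "L2_norm (\<lambda>t. f t - g t) = L2_norm (\<lambda>t. g t - f t)"
    by (simp add: L2_norm_def norm_minus_commute)
  assume fg: "f \<in> PW" "g \<in> PW"
  then have d: "square_integrable (\<lambda>t. f t - g t)"
    by (auto simp: PW_def intro: square_integrable_diff)
  show "(L2_norm (\<lambda>t. f t - g t) = 0) = (f = g)"
  proof
    assume "L2_norm (\<lambda>t. f t - g t) = 0"
    then have "f t - g t = 0" for t
      using L2_norm_eq_0_continuous[OF d] fg by (auto simp: PW_def intro!: continuous_on_diff)
    then show "f = g" by auto
  qed (simp add: L2_norm_def)
  fix h :: "real \<Rightarrow> complex" assume "h \<in> PW"
  then have "square_integrable (\<lambda>t. g t - h t)"
    using fg by (auto simp: PW_def intro: square_integrable_diff)
  from square_integrable_add(2)[OF d this]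
  show "L2_norm (\<lambda>t. f t - h t) \<le> L2_norm (\<lambda>t. f t - g t) + L2_norm (\<lambda>t. g t - h t)"
    by simp
qed

lemma ell2_add:
  assumes a: "a \<in> ell2" and b: "b \<in> ell2"
  shows "(\<lambda>k. a k + b k) \<in> ell2"
    and "ell2_norm (\<lambda>k. a k + b k) \<le> ell2_norm a + ell2_norm b"
proof -
  have i: "(\<lambda>k. (cmod (a k))\<^sup>2) summable_on UNIV" "(\<lambda>k. (cmod (b k))\<^sup>2) summable_on UNIV"
    using a b by (auto simp: ell2_def)
  have *: "(\<lambda>k. (1 + s) * (cmod (a k))\<^sup>2 + (1 + 1 / s) * (cmod (b k))\<^sup>2) summable_on UNIV" for s
    using i by (intro summable_on_add summable_on_cmult_right)
  have j: "(\<lambda>k. (cmod (a k + b k))\<^sup>2) summable_on UNIV"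
    by (rule summable_on_comparison_test[OF *[of 1]]) (use norm_add_sq_le[of 1] in auto)
  then show "(\<lambda>k. a k + b k) \<in> ell2" by (simp add: ell2_def)
  show "ell2_norm (\<lambda>k. a k + b k) \<le> ell2_norm a + ell2_norm b"
    unfolding ell2_norm_def
  proof (rule sqrt_le_sum_sqrt)
    fix s :: real assume s: "s > 0"
    have "(\<Sum>\<^sub>\<infinity>k. (cmod (a k + b k))\<^sup>2) \<le>
          (\<Sum>\<^sub>\<infinity>k. (1 + s) * (cmod (a k))\<^sup>2 + (1 + 1 / s) * (cmod (b k))\<^sup>2)"
      by (intro infsum_mono j * norm_add_sq_le s)
    also have "\<dots> = (1 + s) * (\<Sum>\<^sub>\<infinity>k. (cmod (a k))\<^sup>2) + (1 + 1 / s) * (\<Sum>\<^sub>\<infinity>k. (cmod (b k))\<^sup>2)"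
      using i by (simp add: infsum_add summable_on_cmult_right infsum_cmult_right')
    finally show "(\<Sum>\<^sub>\<infinity>k. (cmod (a k + b k))\<^sup>2) \<le>
          (1 + s) * (\<Sum>\<^sub>\<infinity>k. (cmod (a k))\<^sup>2) + (1 + 1 / s) * (\<Sum>\<^sub>\<infinity>k. (cmod (b k))\<^sup>2)" .
  qed (auto intro: infsum_nonneg)
qed

lemma ell2_diff:
  assumes "a \<in> ell2" "b \<in> ell2"
  shows "(\<lambda>k. a k - b k) \<in> ell2"
proof -
  have "(\<lambda>k. - b k) \<in> ell2" using assms(2) by (simp add: ell2_def)
  from ell2_add(1)[OF assms(1) this] show ?thesis by simp
qed

lemma Metric_space_ell2: "Metric_space ell2 (\<lambda>a b. ell2_norm (\<lambda>k. a k - b k))"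
proof
  fix a b :: "int \<Rightarrow> complex"
  show "0 \<le> ell2_norm (\<lambda>k. a k - b k)" by (simp add: ell2_norm_def infsum_nonneg)
  show "ell2_norm (\<lambda>k. a k - b k) = ell2_norm (\<lambda>k. b k - a k)"
    by (simp add: ell2_norm_def norm_minus_commute)
  assume ab: "a \<in> ell2" "b \<in> ell2"
  have d: "(\<lambda>k. a k - b k) \<in> ell2" by (rule ell2_diff[OF ab])
  show "(ell2_norm (\<lambda>k. a k - b k) = 0) = (a = b)"
  proof
    assume z: "ell2_norm (\<lambda>k. a k - b k) = 0"
    have "(cmod (a k - b k))\<^sup>2 = 0" for k
      by (rule nonneg_infsum_le_0D[where A = UNIV])
        (use z d in \<open>auto simp: ell2_norm_def ell2_def\<close>)
    then show "a = b" by auto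
  qed (simp add: ell2_norm_def)
  fix c :: "int \<Rightarrow> complex" assume "c \<in> ell2"
  then have "(\<lambda>k. b k - c k) \<in> ell2" using ab ell2_diff by blast
  from ell2_add(2)[OF d this]
  show "ell2_norm (\<lambda>k. a k - c k) \<le> ell2_norm (\<lambda>k. a k - b k) + ell2_norm (\<lambda>k. b k - c k)"
    by simp
qed

lemma mspace_PW_metric [simp]: "mspace PW_metric = PW"
  and mdist_PW_metric [simp]: "mdist PW_metric f g = L2_norm (\<lambda>t. f t - g t)"
  by (simp_all add: PW_metric_def Metric_space.mspace_metric[OF Metric_space_PW]
      Metric_space.mdist_metric[OF Metric_space_PW])

lemma mspace_ell2_metric [simp]: "mspace ell2_metric = ell2"
  and mdist_ell2_metric [simp]: "mdist ell2_metric a b = ell2_norm (\<lambda>k. a k - b k)"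
  by (simp_all add: ell2_metric_def Metric_space.mspace_metric[OF Metric_space_ell2]
      Metric_space.mdist_metric[OF Metric_space_ell2])

lemma mspace_folded_range_metric:
  assumes "sampling_set x" "V \<subseteq> PW"
  shows "mspace (folded_range_metric x V) = folded_sample x ` V"
  using assms folded_sample_in_ell2
  by (fastforce simp: folded_range_metric_def sampling_set_def)

lemma mdist_folded_range_metric [simp]:
  "mdist (folded_range_metric x V) a b = ell2_norm (\<lambda>k. a k - b k)"
  by (simp add: folded_range_metric_def)

end

theory Submission
  imports Defs "HOL-Probability.Probability"
begin

text \<open>
  Write \<open>C f\<close> for the samples of \<open>f\<close>, \<open>M f\<close> for the folded samples and \<open>R\<close> for the range of \<open>C\<close> on the
  Paley-Wiener space. Folding subtracts twice a Gaussian integer from every sample, so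
  \<open>M f - M g = C (f - g) - 2 n\<close> with a square summable sequence \<open>n\<close> of Gaussian integers, and the
  norm of the left-hand side is twice the distance of \<open>n\<close> from the point \<open>C ((f - g) / 2)\<close> of \<open>R\<close>.

  If all nonzero \<open>n\<close> stay at a distance at least \<open>\<delta> > 0\<close> from \<open>R\<close>, then \<open>M f\<close> and \<open>M g\<close> can be
  closer than \<open>2 \<delta>\<close> only if \<open>n = 0\<close>. Then \<open>M f - M g = C (f - g)\<close>, and the lower sampling
  bound controls \<open>f - g\<close>, uniformly in \<open>f\<close> and \<open>g\<close>. Conversely, suppose that \<open>C f\<close> is very close
  to some \<open>n \<noteq> 0\<close>. Folding does not see \<open>2 n\<close> and does not increase absolute values, so
  \<open>M (2 f)\<close> has at most twice the norm of \<open>C f - n\<close>. If the left inverse is continuous at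
  \<open>M 0 = 0\<close>, then \<open>f\<close> is small, hence \<open>C f\<close> and \<open>n\<close> are small, although \<open>n\<close> has norm at least 1.
  Continuity at the single point 0 therefore already forces a positive distance, and continuity and
  uniform continuity coincide. The argument uses few properties of the signal space and of the
  integer sequences; the locale \<open>folded_sampling\<close> lists them, and the complex and the real
  version of the theorem are two instances.

  The numbers \<open>Delta\<close> and \<open>Delta_real\<close> are defined through orthogonal projections. To read them as
  distances from \<open>R\<close> one needs that every square summable sequence has a nearest point in \<open>R\<close>.
  The parallelogram law makes a minimizing sequence in \<open>R\<close> Cauchy, and the sampling bounds carry
  this over to the Paley-Wiener space, so what is needed is the completeness of that
  space (\<open>PW_complete\<close>). In the real case, replacing \<open>f\<close> by its real part does not increase the
  distance of \<open>C f\<close> from a real sequence, so real signals suffice.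

  Completeness of the Paley-Wiener space rests on two facts from Fourier analysis. The
  inequality \<open>L2_norm g \<le> L2_norm f\<close> for a transform \<open>g\<close> of \<open>f\<close> makes the transforms of a
  Cauchy sequence Cauchy, so that they have a limit, again supported in \<open>[-1/2, 1/2]\<close>. The
  bound \<open>cmod (f t) \<le> L2_norm f\<close> (\<open>PW_pointwise_le_L2_norm\<close>) makes the sequence itself
  converge uniformly, so that the limit is continuous. Both follow from one identity,
  \<open>fourier_integral_gaussian_pairing\<close>: a Gaussian factor in the frequency variable turns the pairing
  of two transforms into a pairing in which one function is averaged against a normal density.
\<close>

section \<open>Square integrable functions\<close>

lemma L2_norm_nonneg [simp]: "0 \<le> L2_norm f"
  by (simp add: L2_norm_def)

lemma L2_norm_power2: "(L2_norm f)\<^sup>2 = (LINT t|lborel. (cmod (f t))\<^sup>2)"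
  by (simp add: L2_norm_def)

lemma L2_norm_minus_commute: "L2_norm (\<lambda>t. f t - g t) = L2_norm (\<lambda>t. g t - f t)"
  by (simp add: L2_norm_def norm_minus_commute)

lemma square_integrable_cmult:
  assumes "square_integrable f"
  shows "square_integrable (\<lambda>t. c * f t)" and "L2_norm (\<lambda>t. c * f t) = cmod c * L2_norm f"
proof -
  show "square_integrable (\<lambda>t. c * f t)"
    using assms by (auto simp: square_integrable_def norm_mult power_mult_distrib)
  show "L2_norm (\<lambda>t. c * f t) = cmod c * L2_norm f"
    by (simp add: L2_norm_def norm_mult power_mult_distrib real_sqrt_mult)
qed

lemma nn_integral_square_integrable:
  assumes "square_integrable f"
  shows "(\<integral>\<^sup>+t. ennreal ((cmod (f t))\<^sup>2) \<partial>lborel) = ennreal ((L2_norm f)\<^sup>2)"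
  using assms by (simp add: L2_norm_power2 square_integrable_def nn_integral_eq_integral)

text \<open>
  Bounds on nonnegative integrals yield integrability and a norm bound together, whereas the Bochner
  integral of a non-integrable function is zero and bounds nothing.
\<close>
lemma square_integrable_nn_integralI:
  assumes [measurable]: "f \<in> borel_measurable lborel" and c: "0 \<le> c"
    and le: "(\<integral>\<^sup>+t. ennreal ((cmod (f t))\<^sup>2) \<partial>lborel) \<le> ennreal (c\<^sup>2)"
  shows "square_integrable f" and "L2_norm f \<le> c"
proof -
  have "integrable lborel (\<lambda>t. (cmod (f t))\<^sup>2)"
    by (rule integrableI_bounded) (use le in \<open>auto simp: less_top[symmetric] top_unique\<close>)
  then show sq: "square_integrable f"
    by (simp add: square_integrable_def)
  have "ennreal ((L2_norm f)\<^sup>2) \<le> ennreal (c\<^sup>2)"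
    using le nn_integral_square_integrable[OF sq] by simp
  then show "L2_norm f \<le> c"
    using c by (subst (asm) ennreal_le_iff) (simp, rule power2_le_imp_le)
qed

lemma ennreal_power2_le_imp_le:
  fixes x :: ennreal
  assumes "x\<^sup>2 \<le> (ennreal c)\<^sup>2" and "0 \<le> c"
  shows "x \<le> ennreal c"
proof (cases x)
  case (real r)
  then have "ennreal (r\<^sup>2) \<le> ennreal (c\<^sup>2)"
    using assms by (simp only: ennreal_power)
  then show ?thesis using real assms by (simp add: ennreal_leI abs_le_square_iff[symmetric])
next
  case top
  then have "top\<^sup>2 \<le> ennreal (c\<^sup>2)"
    using assms by (simp only: ennreal_power)
  then show ?thesis by (simp add: power2_eq_square ennreal_top_mult top_unique)
qed

lemma L2_Cauchy_Schwarz: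
  assumes f: "square_integrable f" and g: "square_integrable g"
  shows "integrable lborel (\<lambda>t. f t * g t)"
    and "cmod (LINT t|lborel. f t * g t) \<le> L2_norm f * L2_norm g"
proof -
  have [measurable]: "f \<in> borel_measurable lborel" "g \<in> borel_measurable lborel"
    using f g by (auto simp: square_integrable_def)
  have "(\<integral>\<^sup>+t. ennreal (cmod (f t)) * ennreal (cmod (g t)) \<partial>lborel)\<^sup>2 \<le>
      (\<integral>\<^sup>+t. (ennreal (cmod (f t)))\<^sup>2 \<partial>lborel) * (\<integral>\<^sup>+t. (ennreal (cmod (g t)))\<^sup>2 \<partial>lborel)"
    by (rule Cauchy_Schwarz_nn_integral) auto
  also have "\<dots> = ennreal ((L2_norm f * L2_norm g)\<^sup>2)"
    using nn_integral_square_integrable[OF f] nn_integral_square_integrable[OF g]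
    by (simp add: ennreal_power ennreal_mult' power_mult_distrib)
  also have "ennreal ((L2_norm f * L2_norm g)\<^sup>2) = (ennreal (L2_norm f * L2_norm g))\<^sup>2"
    by (simp only: ennreal_power L2_norm_nonneg mult_nonneg_nonneg)
  finally have sq: "(\<integral>\<^sup>+t. ennreal (cmod (f t * g t)) \<partial>lborel)\<^sup>2 \<le> (ennreal (L2_norm f * L2_norm g))\<^sup>2"
    by (simp only: ennreal_mult' norm_mult norm_ge_zero)
  have le: "(\<integral>\<^sup>+t. ennreal (cmod (f t * g t)) \<partial>lborel) \<le> ennreal (L2_norm f * L2_norm g)"
    using sq by (rule ennreal_power2_le_imp_le) simp
  show i: "integrable lborel (\<lambda>t. f t * g t)"
    by (rule integrableI_bounded) (use le in \<open>auto simp: less_top[symmetric] top_unique\<close>)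
  have "ennreal (cmod (LINT t|lborel. f t * g t)) \<le> ennreal (L2_norm f * L2_norm g)"
    using integral_norm_bound_ennreal[OF i] le by (rule order_trans)
  then show "cmod (LINT t|lborel. f t * g t) \<le> L2_norm f * L2_norm g"
    by simp
qed

section \<open>Gaussian regularization of Fourier integrals\<close>

text \<open>
  Fubini's theorem applies since the kernel is bounded and \<open>u\<close>, \<open>v\<close> are integrable. With
  exponential kernels this moves a Fourier transform from one factor of a pairing to the other.
\<close>
lemma integral_kernel_swap:
  fixes u v :: "real \<Rightarrow> complex" and K :: "real \<Rightarrow> real \<Rightarrow> complex"
  assumes u: "integrable lborel u" and v: "integrable lborel v"
    and K [measurable]: "(\<lambda>(a, b). K a b) \<in> borel_measurable (lborel \<Otimes>\<^sub>M lborel)"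
    and bound: "\<And>a b. cmod (K a b) \<le> 1"
  shows "(LINT a|lborel. u a * (LINT b|lborel. v b * K a b)) =
         (LINT b|lborel. v b * (LINT a|lborel. u a * K a b))"
proof -
  have [measurable]: "u \<in> borel_measurable lborel" "v \<in> borel_measurable lborel"
    using u v by auto
  have vK: "integrable lborel (\<lambda>b. v b * K a b)" for a
    by (rule Bochner_Integration.integrable_bound[OF v])
      (auto simp: norm_mult mult_left_le bound)
  have "integrable (lborel \<Otimes>\<^sub>M lborel) (\<lambda>(a, b). u a * v b)"
  proof (rule lborel_pair.Fubini_integrable)
    show "integrable lborel (\<lambda>a. LINT b|lborel. norm (case (a, b) of (a, b) \<Rightarrow> u a * v b))"
      using u by (simp add: norm_mult)
  qed (use v in auto)
  then have "integrable (lborel \<Otimes>\<^sub>M lborel) (\<lambda>(a, b). u a * v b * K a b)"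
    by (rule Bochner_Integration.integrable_bound)
      (auto simp: norm_mult mult_left_le bound)
  from lborel_pair.Fubini_integral[OF this]
  have "(LINT b|lborel. LINT a|lborel. u a * v b * K a b) =
      (LINT a|lborel. LINT b|lborel. u a * v b * K a b)"
    by simp
  moreover have "(LINT b|lborel. u a * v b * K a b) = u a * (LINT b|lborel. v b * K a b)" for a
    by (simp add: mult.assoc)
  moreover have "(LINT a|lborel. u a * v b * K a b) = v b * (LINT a|lborel. u a * K a b)" for b
    by (simp add: mult.assoc mult.left_commute[of _ "v b"])
  ultimately show ?thesis by simp
qed

lemma measurable_cnj [measurable]: "cnj \<in> borel_measurable borel"
  by (intro borel_measurable_continuous_onI continuous_intros)

text \<open>
  The scaling is chosen such that the transform of \<open>gaussian s\<close> is the centred normal density of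
  standard deviation \<open>s\<close>; for \<open>s\<close> tending to 0 the function tends to 1 and the density to a
  point mass.
\<close>
definition gaussian :: "real \<Rightarrow> real \<Rightarrow> complex" where
  "gaussian s \<xi> = complex_of_real (exp (- (2 * pi * s * \<xi>)\<^sup>2 / 2))"

lemma gaussian_eq: "gaussian s \<xi> = complex_of_real (sqrt (2 * pi) * std_normal_density (2 * pi * s * \<xi>))"
  by (simp add: gaussian_def std_normal_density_def)

lemma cmod_gaussian_le_1: "cmod (gaussian s \<xi>) \<le> 1"
  by (simp add: gaussian_def)

lemma measurable_gaussian [measurable]: "gaussian s \<in> borel_measurable borel"
  unfolding gaussian_def[abs_def] by measurable

lemma integrable_gaussian:
  assumes "s > 0" shows "integrable lborel (gaussian s)"
proof -
  have "integrable lborel (\<lambda>x. std_normal_density (0 + (2 * pi * s) * x))"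
    using assms by (intro lborel_integrable_real_affine) auto
  then show ?thesis
    unfolding gaussian_eq[abs_def] by (intro integrable_of_real integrable_mult_right) simp
qed

text \<open>
  After rescaling, this is the characteristic function of the standard normal distribution.
\<close>
lemma fourier_integral_gaussian:
  assumes s: "s > 0"
  shows "fourier_integral (gaussian s) u = complex_of_real (normal_density 0 s u)"
proof -
  let ?g = "\<lambda>y. complex_of_real (std_normal_density y) * exp (\<i> * complex_of_real (- (u / s) * y))"
  have "(LINT y|lborel. ?g y) = char std_normal_distribution (- (u / s))"
    unfolding char_def by (subst integral_density) (auto simp: scaleR_conv_of_real)
  then have 1: "(LINT y|lborel. ?g y) = complex_of_real (exp (- (u / s)\<^sup>2 / 2))"
    by (simp add: char_std_normal_distribution)
  have 2: "(LINT y|lborel. ?g y) = \<bar>2 * pi * s\<bar> *\<^sub>R (LINT \<xi>|lborel. ?g (0 + (2 * pi * s) * \<xi>))"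
    by (rule lborel_integral_real_affine) (use s in auto)
  have "fourier_integral (gaussian s) u = (LINT \<xi>|lborel. complex_of_real (sqrt (2 * pi)) * ?g (0 + (2 * pi * s) * \<xi>))"
    unfolding fourier_integral_def gaussian_eq
    by (intro Bochner_Integration.integral_cong refl) (use s in \<open>simp add: field_simps\<close>)
  also have "\<dots> = complex_of_real (sqrt (2 * pi)) * (LINT \<xi>|lborel. ?g (0 + (2 * pi * s) * \<xi>))"
    by simp
  also have "(LINT \<xi>|lborel. ?g (0 + (2 * pi * s) * \<xi>)) = complex_of_real (exp (- (u / s)\<^sup>2 / 2) / (2 * pi * s))"
    using 1 2 s by (simp add: scaleR_conv_of_real field_simps)
  also have "complex_of_real (sqrt (2 * pi)) * \<dots> = complex_of_real (normal_density 0 s u)"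
  proof -
    have "sqrt (2 * pi) / (2 * pi * s) = 1 / sqrt (2 * pi * s\<^sup>2)"
      using s by (simp add: real_sqrt_mult field_simps)
    then have "sqrt (2 * pi) * (exp (- (u / s)\<^sup>2 / 2) / (2 * pi * s)) =
        1 / sqrt (2 * pi * s\<^sup>2) * exp (- (u / s)\<^sup>2 / 2)"
      by (metis times_divide_eq_left times_divide_eq_right)
    also have "\<dots> = normal_density 0 s u"
      by (simp add: normal_density_def power_divide mult.commute)
    finally have "sqrt (2 * pi) * (exp (- (u / s)\<^sup>2 / 2) / (2 * pi * s)) = normal_density 0 s u" .
    then show ?thesis by (metis of_real_mult)
  qed
  finally show ?thesis .
qed

lemma measurable_fourier_integral [measurable]:
  assumes [measurable]: "h \<in> borel_measurable borel"
  shows "fourier_integral h \<in> borel_measurable borel"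
  unfolding fourier_integral_def[abs_def] by measurable

lemma cmod_fourier_integral_le: 
  "cmod (fourier_integral h \<xi>) \<le> (LINT t|lborel. cmod (h t))"
  unfolding fourier_integral_def
  by (rule order_trans[OF integral_norm_bound]) (simp add: norm_mult)

text \<open>
  The Gaussian makes the left-hand integrand integrable, so that both Fourier integrals can be
  pulled out, first that of \<open>h\<close> and then that of \<open>k\<close>. What is left inside is the transform of the
  Gaussian at \<open>a - b\<close>.
\<close>
lemma fourier_integral_gaussian_pairing:
  assumes h: "integrable lborel h" and k: "integrable lborel k" and s: "s > 0"
  shows "(LINT \<xi>|lborel. fourier_integral h \<xi> * cnj (fourier_integral k \<xi>) * gaussian s \<xi>) =
         (LINT a|lborel. h a * (LINT b|lborel. cnj (k b) * complex_of_real (normal_density 0 s (a - b))))"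
proof -
  let ?E = "\<lambda>t \<xi>. exp (- (2 * complex_of_real pi * \<i> * complex_of_real t * complex_of_real \<xi>))"
  define B where "B = (\<lambda>\<xi>. cnj (fourier_integral k \<xi>) * gaussian s \<xi>)"
  have [measurable]: "h \<in> borel_measurable borel" "k \<in> borel_measurable borel"
    using h k by auto
  have B: "integrable lborel B"
    unfolding B_def
  proof (rule Bochner_Integration.integrable_bound)
    show "integrable lborel (\<lambda>\<xi>. complex_of_real (LINT t|lborel. cmod (k t)) * gaussian s \<xi>)"
      using integrable_gaussian[OF s] by simp
    show "AE \<xi> in lborel. norm (cnj (fourier_integral k \<xi>) * gaussian s \<xi>) \<le>
        norm (complex_of_real (LINT t|lborel. cmod (k t)) * gaussian s \<xi>)"
      using cmod_fourier_integral_le[of k] by (auto simp: norm_mult intro!: mult_right_mono)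
    show "(\<lambda>\<xi>. cnj (fourier_integral k \<xi>) * gaussian s \<xi>) \<in> borel_measurable lborel"
      by simp
  qed
  have inner: "(LINT \<xi>|lborel. B \<xi> * ?E a \<xi>) =
      (LINT b|lborel. cnj (k b) * complex_of_real (normal_density 0 s (a - b)))" for a
  proof -
    \<comment> \<open>Conjugation reverses the frequency, so the integral over \<open>\<xi>\<close> will see \<open>a - b\<close>.\<close>
    have cnjk: "cnj (fourier_integral k \<xi>) = (LINT b|lborel. cnj (k b) * ?E (- b) \<xi>)" for \<xi>
      unfolding fourier_integral_def
      by (subst Bochner_Integration.integral_cnj[symmetric], intro Bochner_Integration.integral_cong refl) (simp add: exp_cnj)
    have E_diff: "?E a \<xi> * ?E (- b) \<xi> = ?E (a - b) \<xi>" for b \<xi>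
      unfolding exp_add[symmetric] by (rule arg_cong[of _ _ exp]) (simp add: left_diff_distrib right_diff_distrib)
    have "(LINT \<xi>|lborel. B \<xi> * ?E a \<xi>) =
        (LINT \<xi>|lborel. (gaussian s \<xi> * ?E a \<xi>) * (LINT b|lborel. cnj (k b) * ?E (- b) \<xi>))"
      unfolding B_def cnjk by (intro Bochner_Integration.integral_cong refl) (simp only: mult_ac)
    also have "\<dots> = (LINT b|lborel. cnj (k b) * (LINT \<xi>|lborel. (gaussian s \<xi> * ?E a \<xi>) * ?E (- b) \<xi>))"
    proof (rule integral_kernel_swap)
      show "integrable lborel (\<lambda>\<xi>. gaussian s \<xi> * ?E a \<xi>)"
        by (rule Bochner_Integration.integrable_bound[OF integrable_gaussian[OF s]]) (simp_all add: norm_mult)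
      show "integrable lborel (\<lambda>b. cnj (k b))" using k by simp
      show "(\<lambda>(\<xi>, b). ?E (- b) \<xi>) \<in> borel_measurable (lborel \<Otimes>\<^sub>M lborel)" by measurable
    qed (simp)
    also have "\<dots> = (LINT b|lborel. cnj (k b) * fourier_integral (gaussian s) (a - b))"
    proof (intro Bochner_Integration.integral_cong refl arg_cong2[of _ _ _ _ "(*)"])
      fix b
      show "(LINT \<xi>|lborel. (gaussian s \<xi> * ?E a \<xi>) * ?E (- b) \<xi>) = fourier_integral (gaussian s) (a - b)"
        unfolding fourier_integral_def
      proof (intro Bochner_Integration.integral_cong refl)
        fix \<xi>
        have "(gaussian s \<xi> * ?E a \<xi>) * ?E (- b) \<xi> = gaussian s \<xi> * ?E (a - b) \<xi>"
          using E_diff[of \<xi> b] by (simp only: mult.assoc)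
        also have "?E (a - b) \<xi> = ?E \<xi> (a - b)"
          by (rule arg_cong[of _ _ exp]) (simp only: mult_ac)
        finally show "(gaussian s \<xi> * ?E a \<xi>) * ?E (- b) \<xi> = gaussian s \<xi> * ?E \<xi> (a - b)" .
      qed
    qed
    finally show ?thesis using s by (simp add: fourier_integral_gaussian)
  qed
  have "(LINT \<xi>|lborel. fourier_integral h \<xi> * cnj (fourier_integral k \<xi>) * gaussian s \<xi>) =
      (LINT \<xi>|lborel. B \<xi> * (LINT a|lborel. h a * ?E a \<xi>))"
    unfolding B_def fourier_integral_def[of h]
    by (intro Bochner_Integration.integral_cong refl) (simp only: mult_ac)
  also have "\<dots> = (LINT a|lborel. h a * (LINT \<xi>|lborel. B \<xi> * ?E a \<xi>))"
  proof (rule integral_kernel_swap[OF B h])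
    show "(\<lambda>(\<xi>, a). ?E a \<xi>) \<in> borel_measurable (lborel \<Otimes>\<^sub>M lborel)" by measurable
  qed simp
  finally show ?thesis using inner by simp
qed

section \<open>The inequality of Bessel and the identity of Parseval\<close>

lemma norm_integral_le_nn_integral:
  fixes f :: "'a \<Rightarrow> complex"
  shows "ennreal (cmod (LINT x|M. f x)) \<le> (\<integral>\<^sup>+x. ennreal (cmod (f x)) \<partial>M)"
  by (cases "integrable M f") (auto simp: integral_norm_bound_ennreal not_integrable_integral_eq)

text \<open>
  Read as a function of either variable the kernel is a probability density, so both marginals
  integrate to 1.
\<close>
lemma normal_density_diff: "normal_density 0 s (a - b) = normal_density a s b"
  "normal_density 0 s (a - b) = normal_density b s a"
  by (simp_all add: normal_density_def power2_commute)

lemma nn_integral_normal_density: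
  assumes "s > 0" shows "(\<integral>\<^sup>+x. ennreal (normal_density m s x) \<partial>lborel) = 1"
  using assms by (subst nn_integral_eq_integral) auto

text \<open>
  By \<open>2 u v \<le> u\<^sup>2 + v\<^sup>2\<close> the double integral splits into two halves. In each of them the variable that
  occurs only in the density integrates to 1.
\<close>
lemma nn_integral_normal_convolution_le:
  assumes h: "square_integrable h" and s: "s > 0"
  shows "(\<integral>\<^sup>+a. \<integral>\<^sup>+b. ennreal (cmod (h a) * (cmod (h b) * normal_density 0 s (a - b))) \<partial>lborel \<partial>lborel)
    \<le> ennreal ((L2_norm h)\<^sup>2)" (is "?L \<le> _")
proof -
  have [measurable]: "h \<in> borel_measurable borel"
    using h by (simp add: square_integrable_def)
  let ?n = "\<lambda>a b. ennreal (normal_density 0 s (a - b))"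
  let ?q = "\<lambda>a. ennreal ((cmod (h a))\<^sup>2 / 2)"
  have pt: "ennreal (cmod (h a) * (cmod (h b) * normal_density 0 s (a - b))) \<le> ?q a * ?n a b + ?q b * ?n a b" for a b
  proof -
    have "0 \<le> (cmod (h a) - cmod (h b))\<^sup>2" by simp
    then have "cmod (h a) * cmod (h b) \<le> (cmod (h a))\<^sup>2 / 2 + (cmod (h b))\<^sup>2 / 2"
      by (simp add: power2_diff)
    then have "cmod (h a) * cmod (h b) * normal_density 0 s (a - b) \<le>
        ((cmod (h a))\<^sup>2 / 2 + (cmod (h b))\<^sup>2 / 2) * normal_density 0 s (a - b)"
      by (intro mult_right_mono) auto
    then have "ennreal (cmod (h a) * (cmod (h b) * normal_density 0 s (a - b))) \<le>
        ennreal ((cmod (h a))\<^sup>2 / 2 * normal_density 0 s (a - b) + (cmod (h b))\<^sup>2 / 2 * normal_density 0 s (a - b))"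
      by (intro ennreal_leI) (simp add: algebra_simps)
    also have "\<dots> = ?q a * ?n a b + ?q b * ?n a b"
      by (subst ennreal_plus) (auto simp: ennreal_mult simp del: times_divide_eq_left)
    finally show ?thesis .
  qed
  have half: "(\<integral>\<^sup>+a. ?q a \<partial>lborel) = ennreal ((L2_norm h)\<^sup>2 / 2)"
    using h by (subst nn_integral_eq_integral) (auto simp: square_integrable_def L2_norm_power2)
  have "?L \<le> (\<integral>\<^sup>+a. \<integral>\<^sup>+b. ?q a * ?n a b + ?q b * ?n a b \<partial>lborel \<partial>lborel)"
    by (intro nn_integral_mono pt)
  also have "\<dots> = (\<integral>\<^sup>+a. (\<integral>\<^sup>+b. ?q a * ?n a b \<partial>lborel) + (\<integral>\<^sup>+b. ?q b * ?n a b \<partial>lborel) \<partial>lborel)"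
    by (intro nn_integral_cong nn_integral_add) measurable
  also have "\<dots> = (\<integral>\<^sup>+a. \<integral>\<^sup>+b. ?q a * ?n a b \<partial>lborel \<partial>lborel) + (\<integral>\<^sup>+a. \<integral>\<^sup>+b. ?q b * ?n a b \<partial>lborel \<partial>lborel)"
    by (intro nn_integral_add) measurable
  also have "(\<integral>\<^sup>+a. \<integral>\<^sup>+b. ?q b * ?n a b \<partial>lborel \<partial>lborel) = (\<integral>\<^sup>+b. \<integral>\<^sup>+a. ?q b * ?n a b \<partial>lborel \<partial>lborel)"
    by (rule lborel_pair.Fubini') measurable
  also have "(\<integral>\<^sup>+a. \<integral>\<^sup>+b. ?q a * ?n a b \<partial>lborel \<partial>lborel) = (\<integral>\<^sup>+a. ?q a \<partial>lborel)"
    unfolding normal_density_diff(1)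
    by (intro nn_integral_cong) (simp add: nn_integral_cmult nn_integral_normal_density s)
  also have "(\<integral>\<^sup>+b. \<integral>\<^sup>+a. ?q b * ?n a b \<partial>lborel \<partial>lborel) = (\<integral>\<^sup>+b. ?q b \<partial>lborel)"
    unfolding normal_density_diff(2)
    by (intro nn_integral_cong) (simp add: nn_integral_cmult nn_integral_normal_density s)
  finally show ?thesis
    unfolding half by (simp flip: ennreal_plus)
qed

text \<open>
  The pairing identity with \<open>h = k\<close>, whose right-hand side is bounded by the preceding lemma.
\<close>
lemma fourier_integral_Bessel_regularized:
  assumes h: "integrable lborel h" "square_integrable h" and s: "s > 0"
  shows "(\<integral>\<^sup>+\<xi>. ennreal ((cmod (fourier_integral h \<xi>))\<^sup>2 * exp (- (2 * pi * s * \<xi>)\<^sup>2 / 2)) \<partial>lborel)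
    \<le> ennreal ((L2_norm h)\<^sup>2)"
proof -
  have [measurable]: "h \<in> borel_measurable borel"
    using h by (simp add: square_integrable_def)
  let ?p = "\<lambda>\<xi>. (cmod (fourier_integral h \<xi>))\<^sup>2 * exp (- (2 * pi * s * \<xi>)\<^sup>2 / 2)"
  let ?C = "LINT t|lborel. cmod (h t)"
  have p: "integrable lborel ?p"
  proof (rule Bochner_Integration.integrable_bound)
    show "integrable lborel (\<lambda>\<xi>. complex_of_real (?C\<^sup>2) * gaussian s \<xi>)"
      using integrable_gaussian[OF s] by (intro integrable_mult_right) auto
    show "AE \<xi> in lborel. norm (?p \<xi>) \<le> norm (complex_of_real (?C\<^sup>2) * gaussian s \<xi>)"
    proof (intro AE_I2)
      fix \<xi>
      have "(cmod (fourier_integral h \<xi>))\<^sup>2 \<le> ?C\<^sup>2"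
        by (intro power_mono cmod_fourier_integral_le) simp
      then show "norm (?p \<xi>) \<le> norm (complex_of_real (?C\<^sup>2) * gaussian s \<xi>)"
        by (simp add: gaussian_def norm_mult norm_power)
    qed
  qed measurable
  have "complex_of_real (LINT \<xi>|lborel. ?p \<xi>) =
      (LINT \<xi>|lborel. fourier_integral h \<xi> * cnj (fourier_integral h \<xi>) * gaussian s \<xi>)"
    unfolding integral_complex_of_real[symmetric] gaussian_def
    by (intro Bochner_Integration.integral_cong refl) (simp add: complex_norm_square[symmetric])
  also have "\<dots> = (LINT a|lborel. h a * (LINT b|lborel. cnj (h b) * complex_of_real (normal_density 0 s (a - b))))"
    by (rule fourier_integral_gaussian_pairing) (use h s in auto)
  finally have "cmod (complex_of_real (LINT \<xi>|lborel. ?p \<xi>)) =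
      cmod (LINT a|lborel. h a * (LINT b|lborel. cnj (h b) * complex_of_real (normal_density 0 s (a - b))))"
    by (rule arg_cong)
  then have eq: "(LINT \<xi>|lborel. ?p \<xi>) =
      cmod (LINT a|lborel. h a * (LINT b|lborel. cnj (h b) * complex_of_real (normal_density 0 s (a - b))))"
    by (simp add: integral_nonneg_AE)
  have "(\<integral>\<^sup>+\<xi>. ennreal (?p \<xi>) \<partial>lborel) = ennreal (LINT \<xi>|lborel. ?p \<xi>)"
    by (rule nn_integral_eq_integral[OF p]) auto
  also have "\<dots> \<le> (\<integral>\<^sup>+a. ennreal (cmod (h a * (LINT b|lborel. cnj (h b) * complex_of_real (normal_density 0 s (a - b))))) \<partial>lborel)"
    unfolding eq by (rule norm_integral_le_nn_integral)
  also have "\<dots> \<le> (\<integral>\<^sup>+a. ennreal (cmod (h a)) * (\<integral>\<^sup>+b. ennreal (cmod (cnj (h b) * complex_of_real (normal_density 0 s (a - b)))) \<partial>lborel) \<partial>lborel)"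
    by (intro nn_integral_mono) (simp only: norm_mult[of "h _"] ennreal_mult norm_ge_zero mult_left_mono[OF norm_integral_le_nn_integral] zero_le)
  also have "\<dots> = (\<integral>\<^sup>+a. \<integral>\<^sup>+b. ennreal (cmod (h a) * (cmod (h b) * normal_density 0 s (a - b))) \<partial>lborel \<partial>lborel)"
    by (intro nn_integral_cong) (simp add: nn_integral_cmult[symmetric] ennreal_mult norm_mult)
  also have "\<dots> \<le> ennreal ((L2_norm h)\<^sup>2)"
    by (rule nn_integral_normal_convolution_le[OF h(2) s])
  finally show ?thesis .
qed

lemma inverse_Suc_tendsto_0: "(\<lambda>n. 1 / real (Suc n)) \<longlonglongrightarrow> 0"
  using LIMSEQ_inverse_real_of_nat by (simp add: inverse_eq_divide)

text \<open>
  The Gaussian tends to 1 pointwise, so Fatou's lemma removes it from the regularized inequality.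
\<close>
lemma fourier_integral_Bessel:
  assumes h: "integrable lborel h" "square_integrable h"
  shows "square_integrable (fourier_integral h)"
    and "L2_norm (fourier_integral h) \<le> L2_norm h"
proof -
  have [measurable]: "h \<in> borel_measurable borel"
    using h by (simp add: square_integrable_def)
  let ?w = "\<lambda>n \<xi>. exp (- (2 * pi * (1 / real (Suc n)) * \<xi>)\<^sup>2 / 2)"
  have lim: "(\<lambda>n. ennreal ((cmod (fourier_integral h \<xi>))\<^sup>2 * ?w n \<xi>)) \<longlonglongrightarrow> ennreal ((cmod (fourier_integral h \<xi>))\<^sup>2)" for \<xi>
  proof -
    have "(\<lambda>n. (cmod (fourier_integral h \<xi>))\<^sup>2 * ?w n \<xi>) \<longlonglongrightarrow>
        (cmod (fourier_integral h \<xi>))\<^sup>2 * exp (- (2 * pi * 0 * \<xi>)\<^sup>2 / 2)"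
      by (intro tendsto_intros inverse_Suc_tendsto_0) auto
    then show ?thesis by (intro tendsto_ennrealI) simp
  qed
  have "(\<integral>\<^sup>+\<xi>. ennreal ((cmod (fourier_integral h \<xi>))\<^sup>2) \<partial>lborel) =
      (\<integral>\<^sup>+\<xi>. liminf (\<lambda>n. ennreal ((cmod (fourier_integral h \<xi>))\<^sup>2 * ?w n \<xi>)) \<partial>lborel)"
    by (intro nn_integral_cong lim_imp_Liminf[symmetric] lim) simp
  also have "\<dots> \<le> liminf (\<lambda>n. \<integral>\<^sup>+\<xi>. ennreal ((cmod (fourier_integral h \<xi>))\<^sup>2 * ?w n \<xi>) \<partial>lborel)"
    by (rule nn_integral_liminf) measurable
  also have "\<dots> \<le> liminf (\<lambda>n::nat. ennreal ((L2_norm h)\<^sup>2))"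
    by (intro Liminf_mono always_eventually allI fourier_integral_Bessel_regularized h) simp
  also have "\<dots> = ennreal ((L2_norm h)\<^sup>2)"
    by (rule Liminf_const) simp
  finally have le: "(\<integral>\<^sup>+\<xi>. ennreal ((cmod (fourier_integral h \<xi>))\<^sup>2) \<partial>lborel) \<le> ennreal ((L2_norm h)\<^sup>2)" .
  show "square_integrable (fourier_integral h)" "L2_norm (fourier_integral h) \<le> L2_norm h"
    using square_integrable_nn_integralI[OF _ L2_norm_nonneg le] by auto
qed

text \<open>
  After the substitution \<open>b = a + s y\<close> the density no longer depends on \<open>s\<close>, and dominated
  convergence applies because \<open>k\<close> is bounded.
\<close>
lemma gaussian_mollification_tendsto:
  fixes k :: "real \<Rightarrow> complex"
  assumes [measurable]: "k \<in> borel_measurable borel"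
    and bound: "\<And>t. cmod (k t) \<le> C" and cont: "isCont k a"
  shows "(\<lambda>n. LINT b|lborel. k b * complex_of_real (normal_density 0 (1 / real (Suc n)) (a - b))) \<longlonglongrightarrow> k a"
proof -
  define s where "s n = 1 / real (Suc n)" for n
  have s: "s n > 0" for n by (simp add: s_def)
  have eq: "(LINT b|lborel. k b * complex_of_real (normal_density 0 (s n) (a - b))) =
      (LINT y|lborel. k (a + s n * y) * complex_of_real (std_normal_density y))" for n
  proof -
    have "(LINT b|lborel. k b * complex_of_real (normal_density 0 (s n) (a - b))) =
        \<bar>s n\<bar> *\<^sub>R (LINT y|lborel. k (a + s n * y) * complex_of_real (normal_density 0 (s n) (a - (a + s n * y))))"
      by (rule lborel_integral_real_affine) (use s[of n] in simp)
    also have "\<dots> = (LINT y|lborel. complex_of_real (s n) * (k (a + s n * y) * complex_of_real (normal_density 0 (s n) (a - (a + s n * y)))))"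
      using s[of n] by (simp add: scaleR_conv_of_real)
    also have "\<dots> = (LINT y|lborel. k (a + s n * y) * complex_of_real (std_normal_density y))"
    proof (intro Bochner_Integration.integral_cong refl)
      fix y
      have "s n * normal_density 0 (s n) (a - (a + s n * y)) = std_normal_density y"
        using s[of n] by (simp add: normal_density_def real_sqrt_mult power_mult_distrib)
      then have "complex_of_real (s n) * complex_of_real (normal_density 0 (s n) (a - (a + s n * y))) = complex_of_real (std_normal_density y)"
        by (metis of_real_mult)
      then show "complex_of_real (s n) * (k (a + s n * y) * complex_of_real (normal_density 0 (s n) (a - (a + s n * y)))) =
          k (a + s n * y) * complex_of_real (std_normal_density y)"
        by (metis mult.left_commute)
    qed
    finally show ?thesis .
  qed
  have "(\<lambda>n. LINT y|lborel. k (a + s n * y) * complex_of_real (std_normal_density y)) \<longlonglongrightarrow>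
      (LINT y|lborel. k a * complex_of_real (std_normal_density y))"
  proof (rule integral_dominated_convergence)
    show "integrable lborel (\<lambda>y. C * std_normal_density y)"
      by simp
    show "AE y in lborel. (\<lambda>n. k (a + s n * y) * complex_of_real (std_normal_density y)) \<longlonglongrightarrow>
        k a * complex_of_real (std_normal_density y)"
    proof (intro AE_I2 tendsto_mult tendsto_const)
      fix y
      have "(\<lambda>n. a + s n * y) \<longlonglongrightarrow> a + 0 * y"
        unfolding s_def by (intro tendsto_intros inverse_Suc_tendsto_0)
      then show "(\<lambda>n. k (a + s n * y)) \<longlonglongrightarrow> k a"
        using isCont_tendsto_compose[OF cont] by simp
    qed
    show "AE y in lborel. cmod (k (a + s n * y) * complex_of_real (std_normal_density y)) \<le> C * std_normal_density y" for n
      using bound by (auto simp: norm_mult intro!: mult_right_mono)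
  qed measurable
  also have "(LINT y|lborel. k a * complex_of_real (std_normal_density y)) = k a"
    by (simp del: integral_mult_right_zero add: integral_complex_of_real)
  finally show ?thesis unfolding eq[symmetric] unfolding s_def .
qed

text \<open>
  Both sides of the pairing identity converge as the Gaussian is removed: the left-hand side because
  the product of the transforms is integrable by Bessel's inequality, the right-hand side because the
  averages of \<open>k\<close> converge wherever \<open>k\<close> is continuous. The indicator functions of intervals
  satisfy the hypotheses on \<open>k\<close>.
\<close>
lemma fourier_integral_Parseval:
  assumes h: "integrable lborel h" "square_integrable h"
    and k: "integrable lborel k" "square_integrable k"
    and bound: "\<And>t. cmod (k t) \<le> C" and cont: "AE t in lborel. isCont k t"
  shows "(LINT \<xi>|lborel. fourier_integral h \<xi> * cnj (fourier_integral k \<xi>)) = (LINT t|lborel. h t * cnj (k t))"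
proof (rule LIMSEQ_unique)
  have [measurable]: "h \<in> borel_measurable borel" "k \<in> borel_measurable borel"
    using h k by (auto simp: square_integrable_def)
  define s where "s n = 1 / real (Suc n)" for n
  have s: "s n > 0" for n by (simp add: s_def)
  let ?I = "\<lambda>n a. LINT b|lborel. cnj (k b) * complex_of_real (normal_density 0 (s n) (a - b))"
  let ?X = "\<lambda>n. LINT a|lborel. h a * ?I n a"
  have pair: "(LINT \<xi>|lborel. fourier_integral h \<xi> * cnj (fourier_integral k \<xi>) * gaussian (s n) \<xi>) = ?X n" for n
    by (rule fourier_integral_gaussian_pairing[OF h(1) k(1) s])
  have fk: "square_integrable (\<lambda>\<xi>. cnj (fourier_integral k \<xi>))"
    using fourier_integral_Bessel(1)[OF k] by (simp add: square_integrable_def)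
  have int: "integrable lborel (\<lambda>\<xi>. fourier_integral h \<xi> * cnj (fourier_integral k \<xi>))"
    by (rule L2_Cauchy_Schwarz(1)[OF fourier_integral_Bessel(1)[OF h] fk])
  show "?X \<longlonglongrightarrow> (LINT \<xi>|lborel. fourier_integral h \<xi> * cnj (fourier_integral k \<xi>))"
    unfolding pair[symmetric]
  proof (rule integral_dominated_convergence)
    show "integrable lborel (\<lambda>\<xi>. cmod (fourier_integral h \<xi> * cnj (fourier_integral k \<xi>)))"
      using int by simp
    show "AE \<xi> in lborel. (\<lambda>n. fourier_integral h \<xi> * cnj (fourier_integral k \<xi>) * gaussian (s n) \<xi>)
        \<longlonglongrightarrow> fourier_integral h \<xi> * cnj (fourier_integral k \<xi>)"
    proof (intro AE_I2)
      fix \<xi>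
      have "(\<lambda>n. fourier_integral h \<xi> * cnj (fourier_integral k \<xi>) * gaussian (s n) \<xi>)
        \<longlonglongrightarrow> fourier_integral h \<xi> * cnj (fourier_integral k \<xi>) * complex_of_real (exp (- (2 * pi * 0 * \<xi>)\<^sup>2 / 2))"
        unfolding gaussian_def s_def by (intro tendsto_intros inverse_Suc_tendsto_0) auto
      then show "(\<lambda>n. fourier_integral h \<xi> * cnj (fourier_integral k \<xi>) * gaussian (s n) \<xi>)
        \<longlonglongrightarrow> fourier_integral h \<xi> * cnj (fourier_integral k \<xi>)" by simp
    qed
    show "AE \<xi> in lborel. cmod (fourier_integral h \<xi> * cnj (fourier_integral k \<xi>) * gaussian (s n) \<xi>)
        \<le> cmod (fourier_integral h \<xi> * cnj (fourier_integral k \<xi>))" for n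
      unfolding norm_mult[of _ "gaussian (s n) _"] by (intro AE_I2 mult_left_le cmod_gaussian_le_1) simp
  qed measurable
  show "?X \<longlonglongrightarrow> (LINT t|lborel. h t * cnj (k t))"
  proof (rule integral_dominated_convergence)
    show "integrable lborel (\<lambda>a. cmod (h a) * C)"
      using h by simp
    show "AE a in lborel. (\<lambda>n. h a * ?I n a) \<longlonglongrightarrow> h a * cnj (k a)"
      using cont
    proof eventually_elim
      case (elim a)
      have "isCont (\<lambda>t. cnj (k t)) a"
        using elim by (intro continuous_intros)
      from gaussian_mollification_tendsto[OF _ _ this, of C]
      show ?case unfolding s_def using bound by (intro tendsto_intros) simp_all
    qed
    show "AE a in lborel. cmod (h a * ?I n a) \<le> cmod (h a) * C" for n
    proof (intro AE_I2)
      fix a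
      have "cmod (?I n a) \<le> (LINT b|lborel. C * normal_density a (s n) b)"
      proof (rule Bochner_Integration.integral_norm_bound_integral)
        show "integrable lborel (\<lambda>b. C * normal_density a (s n) b)"
          using s by simp
        show le: "norm (cnj (k b) * complex_of_real (normal_density 0 (s n) (a - b))) \<le> C * normal_density a (s n) b" for b
          unfolding normal_density_diff(1) using bound by (simp add: norm_mult mult_right_mono)
        show "integrable lborel (\<lambda>b. cnj (k b) * complex_of_real (normal_density 0 (s n) (a - b)))"
          by (rule Bochner_Integration.integrable_bound[where f = "\<lambda>b. C * normal_density a (s n) b"])
            (use s le in \<open>auto intro: order_trans[OF _ abs_ge_self]\<close>)
      qed
      then have "cmod (?I n a) \<le> C" using s by simp
      then show "cmod (h a * ?I n a) \<le> cmod (h a) * C"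
        by (simp add: norm_mult mult_left_mono)
    qed
  qed measurable
qed

section \<open>Completeness of the space of square integrable functions\<close>

lemma L2_norm_le_Fatou:
  assumes u: "\<And>n. square_integrable (u n)" and v [measurable]: "v \<in> borel_measurable borel"
    and lim: "AE t in lborel. (\<lambda>n. u n t) \<longlonglongrightarrow> v t"
    and le: "eventually (\<lambda>n. L2_norm (u n) \<le> e) sequentially" and e: "0 \<le> e"
  shows "square_integrable v" and "L2_norm v \<le> e"
proof -
  have [measurable]: "u n \<in> borel_measurable borel" for n
    using u[of n] by (simp add: square_integrable_def)
  have "(\<integral>\<^sup>+t. ennreal ((cmod (v t))\<^sup>2) \<partial>lborel) = (\<integral>\<^sup>+t. liminf (\<lambda>n. ennreal ((cmod (u n t))\<^sup>2)) \<partial>lborel)"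
  proof (rule nn_integral_cong_AE)
    show "AE t in lborel. ennreal ((cmod (v t))\<^sup>2) = liminf (\<lambda>n. ennreal ((cmod (u n t))\<^sup>2))"
      using lim
    proof eventually_elim
      case (elim t)
      have "(\<lambda>n. ennreal ((cmod (u n t))\<^sup>2)) \<longlonglongrightarrow> ennreal ((cmod (v t))\<^sup>2)"
        by (intro tendsto_ennrealI tendsto_intros elim)
      then show ?case by (intro lim_imp_Liminf[symmetric]) simp_all
    qed
  qed
  also have "\<dots> \<le> liminf (\<lambda>n. \<integral>\<^sup>+t. ennreal ((cmod (u n t))\<^sup>2) \<partial>lborel)"
    by (rule nn_integral_liminf) measurable
  also have "\<dots> \<le> liminf (\<lambda>n::nat. ennreal (e\<^sup>2))"
  proof (rule Liminf_mono)
    show "eventually (\<lambda>n. (\<integral>\<^sup>+t. ennreal ((cmod (u n t))\<^sup>2) \<partial>lborel) \<le> ennreal (e\<^sup>2)) sequentially"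
      using le by eventually_elim
        (auto simp: nn_integral_square_integrable[OF u] intro!: ennreal_leI power_mono)
  qed
  also have "\<dots> = ennreal (e\<^sup>2)"
    by (rule Liminf_const) simp
  finally have "(\<integral>\<^sup>+t. ennreal ((cmod (v t))\<^sup>2) \<partial>lborel) \<le> ennreal (e\<^sup>2)" .
  from square_integrable_nn_integralI[OF _ e this] show "square_integrable v" "L2_norm v \<le> e"
    by auto
qed

definition L2_Cauchy :: "(nat \<Rightarrow> real \<Rightarrow> complex) \<Rightarrow> bool" where
  "L2_Cauchy G \<longleftrightarrow> (\<forall>n. square_integrable (G n)) \<and>
     (\<forall>e>0. \<exists>M. \<forall>m\<ge>M. \<forall>n\<ge>M. L2_norm (\<lambda>t. G m t - G n t) < e)"

text \<open>
  The indices \<open>r k\<close> are partial sums of the Cauchy thresholds, which makes them strictly increasing and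
  places each of them at or above its threshold.
\<close>
lemma L2_Cauchy_fast_subsequence:
  assumes "L2_Cauchy G"
  obtains r :: "nat \<Rightarrow> nat" where "strict_mono r"
    "\<And>k. L2_norm (\<lambda>t. G (r (Suc k)) t - G (r k) t) \<le> (1/2) ^ k"
proof -
  have "\<forall>k. \<exists>M. \<forall>m\<ge>M. \<forall>n\<ge>M. L2_norm (\<lambda>t. G m t - G n t) < (1/2) ^ k"
    using assms by (auto simp: L2_Cauchy_def)
  then obtain M where M: "\<And>k m n. m \<ge> M k \<Longrightarrow> n \<ge> M k \<Longrightarrow> L2_norm (\<lambda>t. G m t - G n t) < (1/2) ^ k"
    by metis
  define r where "r k = (\<Sum>i\<le>k. Suc (M i))" for k
  have r: "r k < r (Suc k)" for k by (simp add: r_def)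
  have "M k \<le> r k" for k by (cases k) (auto simp: r_def)
  then have "L2_norm (\<lambda>t. G (r (Suc k)) t - G (r k) t) \<le> (1/2) ^ k" for k
    using M[of k "r (Suc k)" "r k"] r[of k] by (meson less_imp_le order_trans)
  then show thesis
    using that[of r] r by (simp add: strict_mono_Suc_iff)
qed

text \<open>
  The series of \<open>2 ^ k * (cmod (d k t))\<^sup>2\<close>, where \<open>d k\<close> is the difference of consecutive terms, has a
  finite integral, since its terms have integrals at most \<open>(1/2) ^ k\<close>. So it is finite almost
  everywhere, and there \<open>d k t\<close> decays geometrically.
\<close>
lemma L2_fast_Cauchy_AE_convergent:
  assumes G: "\<And>n. square_integrable (G n)"
    and fast: "\<And>k. L2_norm (\<lambda>t. G (Suc k) t - G k t) \<le> (1/2) ^ k"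
  shows "AE t in lborel. convergent (\<lambda>k. G k t)"
proof -
  have [measurable]: "G n \<in> borel_measurable borel" for n
    using G[of n] by (simp add: square_integrable_def)
  define d where "d k t = G (Suc k) t - G k t" for k t
  have dsq: "square_integrable (d k)" for k
    unfolding d_def by (intro square_integrable_diff G)
  have [measurable]: "d n \<in> borel_measurable borel" for n
    using dsq[of n] by (simp add: square_integrable_def)
  have "(\<integral>\<^sup>+t. (\<Sum>k. ennreal (2 ^ k * (cmod (d k t))\<^sup>2)) \<partial>lborel) = (\<Sum>k. \<integral>\<^sup>+t. ennreal (2 ^ k * (cmod (d k t))\<^sup>2) \<partial>lborel)"
    by (rule nn_integral_suminf) measurable
  also have "\<dots> \<le> (\<Sum>k. ennreal ((1/2) ^ k))"
  proof (rule suminf_le)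
    fix k
    have "(\<integral>\<^sup>+t. ennreal (2 ^ k * (cmod (d k t))\<^sup>2) \<partial>lborel) = ennreal (2 ^ k) * ennreal ((L2_norm (d k))\<^sup>2)"
      by (simp add: ennreal_mult nn_integral_cmult nn_integral_square_integrable[OF dsq])
    also have "\<dots> = ennreal (2 ^ k * (L2_norm (d k))\<^sup>2)"
      by (simp add: ennreal_mult)
    also have "2 ^ k * (L2_norm (d k))\<^sup>2 \<le> 2 ^ k * ((1/2) ^ k)\<^sup>2"
      using fast[of k] by (intro mult_left_mono power_mono) (auto simp: d_def[abs_def])
    also have "2 ^ k * ((1/2) ^ k)\<^sup>2 = ((1/2) ^ k :: real)"
      by (simp add: power2_eq_square power_mult_distrib[symmetric])
    finally show "(\<integral>\<^sup>+t. ennreal (2 ^ k * (cmod (d k t))\<^sup>2) \<partial>lborel) \<le> ennreal ((1/2) ^ k)"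
      by (simp add: ennreal_leI)
  qed auto
  also have "\<dots> = ennreal (\<Sum>k. (1/2) ^ k)"
    by (rule suminf_ennreal2) (auto intro: summable_geometric)
  also have "\<dots> < \<infinity>" by simp
  finally have "AE t in lborel. (\<Sum>k. ennreal (2 ^ k * (cmod (d k t))\<^sup>2)) \<noteq> \<infinity>"
    by (intro nn_integral_PInf_AE) auto
  then show ?thesis
  proof eventually_elim
    case (elim t)
    define S where "S = (\<Sum>k. ennreal (2 ^ k * (cmod (d k t))\<^sup>2))"
    have "S \<noteq> \<infinity>" using elim unfolding S_def .
    then obtain C where C: "0 \<le> C" "S = ennreal C" by (cases S) auto
    have le: "cmod (d k t) \<le> sqrt C * (sqrt (1/2)) ^ k" for k
    proof -
      have "(\<Sum>i\<in>{k}. ennreal (2 ^ i * (cmod (d i t))\<^sup>2)) \<le> (\<Sum>i. ennreal (2 ^ i * (cmod (d i t))\<^sup>2))"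
        by (rule sum_le_suminf) auto
      then have "ennreal (2 ^ k * (cmod (d k t))\<^sup>2) \<le> ennreal C"
        unfolding S_def[symmetric] C(2) by simp
      then have "2 ^ k * (cmod (d k t))\<^sup>2 \<le> C"
        using C(1) by (subst (asm) ennreal_le_iff)
      then have "(cmod (d k t))\<^sup>2 \<le> C * (1/2) ^ k"
        by (simp add: field_simps power_divide)
      then have "cmod (d k t) \<le> sqrt (C * (1/2) ^ k)"
        by (intro real_le_rsqrt)
      then show ?thesis by (simp only: real_sqrt_mult real_sqrt_power)
    qed
    have "sqrt (1/2) < sqrt 1" by (simp only: real_sqrt_less_iff)
    then have "summable (\<lambda>k. sqrt C * (sqrt (1/2)) ^ k)"
      by (intro summable_mult summable_geometric) simp
    then have "summable (\<lambda>k. d k t)"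
      by (rule summable_comparison_test') (use le in auto)
    then have "convergent (\<lambda>n. \<Sum>k<n. d k t)"
      by (simp add: summable_iff_convergent)
    then have "convergent (\<lambda>n. (\<Sum>k<n. d k t) + G 0 t)"
      by (intro convergent_add convergent_const)
    moreover have "(\<Sum>k<n. d k t) + G 0 t = G n t" for n
      unfolding d_def by (subst sum_lessThan_telescope) simp
    ultimately show ?case by simp
  qed
qed

text \<open>
  The limit is the pointwise limit of a fast subsequence. The almost everywhere convergence is part of
  the conclusion because it makes \<open>g\<close> vanish wherever all \<open>G n\<close> vanish, up to null sets.
\<close>
lemma L2_complete:
  assumes "L2_Cauchy G"
  obtains g r where "square_integrable g" "(\<lambda>n. L2_norm (\<lambda>t. G n t - g t)) \<longlonglongrightarrow> 0"
    "AE t in lborel. (\<lambda>k. G (r k) t) \<longlonglongrightarrow> g t"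
proof -
  have G: "square_integrable (G n)" for n
    using assms by (simp add: L2_Cauchy_def)
  then have [measurable]: "G n \<in> borel_measurable borel" for n
    by (simp add: square_integrable_def)
  obtain r where r: "strict_mono r" "\<And>k. L2_norm (\<lambda>t. G (r (Suc k)) t - G (r k) t) \<le> (1/2) ^ k"
    using L2_Cauchy_fast_subsequence[OF assms] by blast
  define g where "g t = lim (\<lambda>k. G (r k) t)" for t
  have [measurable]: "g \<in> borel_measurable borel"
    unfolding g_def[abs_def] by measurable
  have ae: "AE t in lborel. (\<lambda>k. G (r k) t) \<longlonglongrightarrow> g t"
    using L2_fast_Cauchy_AE_convergent[of "\<lambda>k. G (r k)", OF G r(2)]
    by eventually_elim (simp add: g_def convergent_LIMSEQ_iff)
  have tail: "\<exists>M. \<forall>n\<ge>M. square_integrable (\<lambda>t. G n t - g t) \<and> L2_norm (\<lambda>t. G n t - g t) \<le> e" if "e > 0" for e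
  proof -
    obtain M where M: "\<And>m n. m \<ge> M \<Longrightarrow> n \<ge> M \<Longrightarrow> L2_norm (\<lambda>t. G m t - G n t) < e"
      using assms \<open>e > 0\<close> unfolding L2_Cauchy_def by blast
    have "square_integrable (\<lambda>t. G n t - g t) \<and> L2_norm (\<lambda>t. G n t - g t) \<le> e" if "n \<ge> M" for n
    proof (intro conjI)
      have "AE t in lborel. (\<lambda>k. G n t - G (r k) t) \<longlonglongrightarrow> G n t - g t"
        using ae by eventually_elim (intro tendsto_intros)
      moreover have "eventually (\<lambda>k. L2_norm (\<lambda>t. G n t - G (r k) t) \<le> e) sequentially"
        using eventually_ge_at_top[of M]
        by eventually_elim
          (rule less_imp_le[OF M[OF \<open>n \<ge> M\<close>]], rule order_trans[OF _ seq_suble[OF r(1)]])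
      ultimately show "square_integrable (\<lambda>t. G n t - g t)" "L2_norm (\<lambda>t. G n t - g t) \<le> e"
        using L2_norm_le_Fatou[of "\<lambda>k t. G n t - G (r k) t" "\<lambda>t. G n t - g t" e]
          square_integrable_diff[OF G G] \<open>e > 0\<close> by auto
    qed
    then show ?thesis by blast
  qed
  obtain n where "square_integrable (\<lambda>t. G n t - g t)"
    using tail[of 1] by auto
  from square_integrable_diff[OF G[of n] this] have "square_integrable g" by simp
  moreover have "(\<lambda>n. L2_norm (\<lambda>t. G n t - g t)) \<longlonglongrightarrow> 0"
  proof (rule LIMSEQ_I)
    fix e :: real assume "e > 0"
    then obtain M where "\<forall>n\<ge>M. L2_norm (\<lambda>t. G n t - g t) \<le> e / 2"
      using tail[of "e / 2"] by auto
    then show "\<exists>M. \<forall>n\<ge>M. norm (L2_norm (\<lambda>t. G n t - g t) - 0) < e"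
      using \<open>e > 0\<close> by (intro exI[of _ M]) fastforce
  qed
  ultimately show thesis using that ae by blast
qed

section \<open>The transform as a limit of truncated transforms\<close>

definition truncation :: "nat \<Rightarrow> (real \<Rightarrow> complex) \<Rightarrow> real \<Rightarrow> complex" where
  "truncation N f = (\<lambda>t. if t \<in> {- real N..real N} then f t else 0)"

lemma square_integrable_indicator_Icc:
  assumes "c \<le> d"
  shows "square_integrable (indicator {c..d})"
    and "integrable lborel (indicator {c..d} :: real \<Rightarrow> complex)"
proof -
  have "integrable lborel (indicator {c..d} :: real \<Rightarrow> real)"
    using assms by (simp add: integrable_indicator_iff)
  moreover have "(\<lambda>t. (cmod (indicator {c..d} t))\<^sup>2) = (indicator {c..d} :: real \<Rightarrow> real)"
    by (auto simp: indicator_def)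
  ultimately show "square_integrable (indicator {c..d})" by (simp add: square_integrable_def)
  have "integrable lborel (\<lambda>t. complex_of_real (indicator {c..d} t))"
    using assms by (intro integrable_of_real) (simp add: integrable_indicator_iff)
  moreover have "(\<lambda>t. complex_of_real (indicator {c..d} t)) = indicator {c..d}"
    by (auto simp: indicator_def)
  ultimately show "integrable lborel (indicator {c..d} :: real \<Rightarrow> complex)" by simp
qed

lemma truncation_square_integrable:
  assumes f: "square_integrable f"
  shows "integrable lborel (truncation N f)" "square_integrable (truncation N f)"
    "L2_norm (truncation N f) \<le> L2_norm f"
proof -
  have [measurable]: "f \<in> borel_measurable borel"
    using f by (simp add: square_integrable_def)
  have eq: "truncation N f = (\<lambda>t. f t * indicator {- real N..real N} t)"
    by (auto simp: truncation_def)
  show "integrable lborel (truncation N f)"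
    unfolding eq by (intro L2_Cauchy_Schwarz(1) f square_integrable_indicator_Icc) simp
  have [measurable]: "truncation N f \<in> borel_measurable borel"
    unfolding eq by measurable
  have "(\<integral>\<^sup>+t. ennreal ((cmod (truncation N f t))\<^sup>2) \<partial>lborel) \<le> (\<integral>\<^sup>+t. ennreal ((cmod (f t))\<^sup>2) \<partial>lborel)"
    by (intro nn_integral_mono) (simp add: truncation_def)
  then have "(\<integral>\<^sup>+t. ennreal ((cmod (truncation N f t))\<^sup>2) \<partial>lborel) \<le> ennreal ((L2_norm f)\<^sup>2)"
    by (simp add: nn_integral_square_integrable[OF f])
  from square_integrable_nn_integralI[OF _ L2_norm_nonneg this]
  show "square_integrable (truncation N f)" "L2_norm (truncation N f) \<le> L2_norm f"
    by auto
qed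

abbreviation truncated_transform :: "nat \<Rightarrow> (real \<Rightarrow> complex) \<Rightarrow> real \<Rightarrow> complex" where
  "truncated_transform N f \<equiv> fourier_integral (truncation N f)"

lemma truncated_transform_square_integrable:
  assumes "square_integrable f"
  shows "square_integrable (truncated_transform N f)" "L2_norm (truncated_transform N f) \<le> L2_norm f"
  by (rule fourier_integral_Bessel(1)[OF truncation_square_integrable(1,2)[OF assms]],
    rule order_trans[OF fourier_integral_Bessel(2)[OF truncation_square_integrable(1,2)[OF assms]]
      truncation_square_integrable(3)[OF assms]])

text \<open>
  By Bessel's inequality the differences in the definition are square integrable, so the nonnegative
  integrals there can be replaced by norms and the triangle inequality becomes available.
\<close>
lemma has_fourier_transform_iff:
  "has_fourier_transform f g \<longleftrightarrow> square_integrable f \<and> square_integrable g \<and>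
     (\<lambda>N. L2_norm (\<lambda>\<xi>. truncated_transform N f \<xi> - g \<xi>)) \<longlonglongrightarrow> 0"
proof (cases "square_integrable f \<and> square_integrable g")
  case True
  then have "(\<integral>\<^sup>+\<xi>. ennreal ((cmod (truncated_transform N f \<xi> - g \<xi>))\<^sup>2) \<partial>lborel) =
      ennreal ((L2_norm (\<lambda>\<xi>. truncated_transform N f \<xi> - g \<xi>))\<^sup>2)" for N
    by (intro nn_integral_square_integrable square_integrable_diff truncated_transform_square_integrable) auto
  moreover have "(\<lambda>N. ennreal ((L2_norm (\<lambda>\<xi>. truncated_transform N f \<xi> - g \<xi>))\<^sup>2)) \<longlonglongrightarrow> ennreal 0 \<longleftrightarrow>
      (\<lambda>N. (L2_norm (\<lambda>\<xi>. truncated_transform N f \<xi> - g \<xi>))\<^sup>2) \<longlonglongrightarrow> 0"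
    by (rule tendsto_ennreal_iff) auto
  moreover have "(\<lambda>N. (L2_norm (\<lambda>\<xi>. truncated_transform N f \<xi> - g \<xi>))\<^sup>2) \<longlonglongrightarrow> 0 \<longleftrightarrow>
      (\<lambda>N. L2_norm (\<lambda>\<xi>. truncated_transform N f \<xi> - g \<xi>)) \<longlonglongrightarrow> 0"
    using tendsto_power[of "\<lambda>N. L2_norm (\<lambda>\<xi>. truncated_transform N f \<xi> - g \<xi>)" 0 sequentially 2]
      tendsto_real_sqrt[of "\<lambda>N. (L2_norm (\<lambda>\<xi>. truncated_transform N f \<xi> - g \<xi>))\<^sup>2" 0 sequentially]
    by auto
  ultimately show ?thesis
    using True by (simp add: has_fourier_transform_def truncation_def)
qed (auto simp: has_fourier_transform_def)

lemma fourier_integral_lincomb: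
  assumes "integrable lborel f" "integrable lborel g"
  shows "fourier_integral (\<lambda>t. a * f t + b * g t) \<xi> = a * fourier_integral f \<xi> + b * fourier_integral g \<xi>"
proof -
  let ?E = "\<lambda>t. exp (- (2 * complex_of_real pi * \<i> * complex_of_real t * complex_of_real \<xi>))"
  have i: "integrable lborel (\<lambda>t. h t * ?E t)" if "integrable lborel h" for h
    by (rule Bochner_Integration.integrable_bound[OF that]) (use that in \<open>auto simp: norm_mult\<close>)
  have "fourier_integral (\<lambda>t. a * f t + b * g t) \<xi> = (LINT t|lborel. a * (f t * ?E t) + b * (g t * ?E t))"
    unfolding fourier_integral_def
    by (intro Bochner_Integration.integral_cong refl) (simp add: distrib_right mult.assoc)
  also have "\<dots> = (LINT t|lborel. a * (f t * ?E t)) + (LINT t|lborel. b * (g t * ?E t))"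
    using assms by (intro Bochner_Integration.integral_add integrable_mult_right i)
  finally show ?thesis by (simp add: fourier_integral_def)
qed

lemma truncated_transform_lincomb:
  assumes "square_integrable f" "square_integrable g"
  shows "truncated_transform N (\<lambda>t. a * f t + b * g t) \<xi> = a * truncated_transform N f \<xi> + b * truncated_transform N g \<xi>"
proof -
  have "truncation N (\<lambda>t. a * f t + b * g t) = (\<lambda>t. a * truncation N f t + b * truncation N g t)"
    by (auto simp: truncation_def)
  then show ?thesis
    by (simp only: fourier_integral_lincomb[OF truncation_square_integrable(1)[OF assms(1)] truncation_square_integrable(1)[OF assms(2)]])
qed

lemma square_integrable_lincomb:
  assumes "square_integrable f" "square_integrable g"
  shows "square_integrable (\<lambda>t. a * f t + b * g t)"
    and "L2_norm (\<lambda>t. a * f t + b * g t) \<le> cmod a * L2_norm f + cmod b * L2_norm g"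
  using square_integrable_add[OF square_integrable_cmult(1)[OF assms(1), of a] square_integrable_cmult(1)[OF assms(2), of b]]
    square_integrable_cmult(2)[OF assms(1), of a] square_integrable_cmult(2)[OF assms(2), of b]
  by auto

lemma has_fourier_transform_lincomb:
  assumes "has_fourier_transform f u" "has_fourier_transform g v"
  shows "has_fourier_transform (\<lambda>t. a * f t + b * g t) (\<lambda>\<xi>. a * u \<xi> + b * v \<xi>)"
  unfolding has_fourier_transform_iff
proof (intro conjI)
  have sq: "square_integrable f" "square_integrable g" "square_integrable u" "square_integrable v"
    and lim: "(\<lambda>N. L2_norm (\<lambda>\<xi>. truncated_transform N f \<xi> - u \<xi>)) \<longlonglongrightarrow> 0"
      "(\<lambda>N. L2_norm (\<lambda>\<xi>. truncated_transform N g \<xi> - v \<xi>)) \<longlonglongrightarrow> 0"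
    using assms by (auto simp: has_fourier_transform_iff)
  show "square_integrable (\<lambda>t. a * f t + b * g t)" "square_integrable (\<lambda>\<xi>. a * u \<xi> + b * v \<xi>)"
    by (intro square_integrable_lincomb sq)+
  let ?D = "\<lambda>N. L2_norm (\<lambda>\<xi>. truncated_transform N (\<lambda>t. a * f t + b * g t) \<xi> - (a * u \<xi> + b * v \<xi>))"
  have le: "?D N \<le> cmod a * L2_norm (\<lambda>\<xi>. truncated_transform N f \<xi> - u \<xi>) + cmod b * L2_norm (\<lambda>\<xi>. truncated_transform N g \<xi> - v \<xi>)" for N
    unfolding truncated_transform_lincomb[OF sq(1,2)]
    using square_integrable_lincomb(2)[OF square_integrable_diff[OF truncated_transform_square_integrable(1)[OF sq(1)] sq(3)]
        square_integrable_diff[OF truncated_transform_square_integrable(1)[OF sq(2)] sq(4)], of a N b N]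
    by (simp add: algebra_simps)
  show "?D \<longlonglongrightarrow> 0"
  proof (rule tendsto_sandwich[OF _ _ tendsto_const])
    show "(\<lambda>N. cmod a * L2_norm (\<lambda>\<xi>. truncated_transform N f \<xi> - u \<xi>) + cmod b * L2_norm (\<lambda>\<xi>. truncated_transform N g \<xi> - v \<xi>)) \<longlonglongrightarrow> 0"
      using tendsto_add[OF tendsto_mult[OF tendsto_const lim(1)] tendsto_mult[OF tendsto_const lim(2)], of "cmod a" "cmod b"] by simp
  qed (use le in auto)
qed

text \<open>
  The truncated transforms satisfy this bound by Bessel's inequality, and it passes to the limit.
\<close>
lemma has_fourier_transform_L2_norm_le:
  assumes "has_fourier_transform f g"
  shows "L2_norm g \<le> L2_norm f"
proof -
  have sq: "square_integrable f" "square_integrable g"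
    and lim: "(\<lambda>N. L2_norm (\<lambda>\<xi>. truncated_transform N f \<xi> - g \<xi>)) \<longlonglongrightarrow> 0"
    using assms by (auto simp: has_fourier_transform_iff)
  have "L2_norm g \<le> L2_norm f + L2_norm (\<lambda>\<xi>. truncated_transform N f \<xi> - g \<xi>)" for N
  proof -
    have "L2_norm (\<lambda>\<xi>. truncated_transform N f \<xi> + - (truncated_transform N f \<xi> - g \<xi>)) \<le>
        L2_norm (truncated_transform N f) + L2_norm (\<lambda>\<xi>. - (truncated_transform N f \<xi> - g \<xi>))"
      by (intro square_integrable_add(2) square_integrable_uminus square_integrable_diff
          truncated_transform_square_integrable sq)
    also have "L2_norm (\<lambda>\<xi>. - (truncated_transform N f \<xi> - g \<xi>)) = L2_norm (\<lambda>\<xi>. truncated_transform N f \<xi> - g \<xi>)"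
      by (simp only: L2_norm_def norm_minus_cancel)
    also have "L2_norm (truncated_transform N f) \<le> L2_norm f"
      by (rule truncated_transform_square_integrable[OF sq(1)])
    finally show ?thesis by simp
  qed
  moreover have "(\<lambda>N. L2_norm f + L2_norm (\<lambda>\<xi>. truncated_transform N f \<xi> - g \<xi>)) \<longlonglongrightarrow> L2_norm f + 0"
    by (intro tendsto_intros lim)
  ultimately show ?thesis
    by (intro LIMSEQ_le_const[where X = "\<lambda>N. L2_norm f + L2_norm (\<lambda>\<xi>. truncated_transform N f \<xi> - g \<xi>)"]) auto
qed

section \<open>The Paley-Wiener space\<close>

lemma PW_square_integrable: "f \<in> PW \<Longrightarrow> square_integrable f"
  by (simp add: PW_def)

lemma PW_lincomb:
  assumes "f \<in> PW" "g \<in> PW"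
  shows "(\<lambda>t. a * f t + b * g t) \<in> PW"
proof -
  obtain u v where u: "has_fourier_transform f u" "AE \<xi> in lborel. \<xi> \<notin> {-1/2..1/2} \<longrightarrow> u \<xi> = 0"
    and v: "has_fourier_transform g v" "AE \<xi> in lborel. \<xi> \<notin> {-1/2..1/2} \<longrightarrow> v \<xi> = 0"
    using assms unfolding PW_def by blast
  have "AE \<xi> in lborel. \<xi> \<notin> {-1/2..1/2} \<longrightarrow> a * u \<xi> + b * v \<xi> = 0"
    using u(2) v(2) by eventually_elim simp
  moreover have "continuous_on UNIV (\<lambda>t. a * f t + b * g t)"
    using assms by (intro continuous_intros) (auto simp: PW_def)
  ultimately show ?thesis
    using has_fourier_transform_lincomb[OF u(1) v(1), of a b]
    unfolding PW_def has_fourier_transform_def by blast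
qed

lemma PW_diff: "f \<in> PW \<Longrightarrow> g \<in> PW \<Longrightarrow> (\<lambda>t. f t - g t) \<in> PW"
  using PW_lincomb[of f g 1 "-1"] by simp

lemma PW_cmult: "f \<in> PW \<Longrightarrow> (\<lambda>t. c * f t) \<in> PW"
  using PW_lincomb[of f f c 0] by simp

lemma L2_norm_reflect: "L2_norm (\<lambda>t. f (- t)) = L2_norm f"
  using lborel_integral_real_affine[of "-1" "\<lambda>t. (cmod (f t))\<^sup>2" 0]
  by (simp add: L2_norm_def)

lemma square_integrable_cnj:
  assumes "square_integrable f"
  shows "square_integrable (\<lambda>t. cnj (f t))"
proof -
  have [measurable]: "f \<in> borel_measurable borel"
    using assms by (simp add: square_integrable_def)
  show ?thesis using assms by (simp add: square_integrable_def)
qed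

lemma square_integrable_cnj_reflect:
  assumes "square_integrable g"
  shows "square_integrable (\<lambda>\<xi>. cnj (g (- \<xi>)))"
proof -
  have [measurable]: "g \<in> borel_measurable borel"
    using assms by (simp add: square_integrable_def)
  show ?thesis
    using assms lborel_integrable_real_affine[of "\<lambda>t. (cmod (g t))\<^sup>2" "-1" 0]
    by (simp add: square_integrable_def)
qed

text \<open>
  Conjugating a signal conjugates and reflects its transform; the band \<open>[-1/2, 1/2]\<close> is symmetric, so
  the Paley-Wiener space is closed under conjugation and under taking real parts.
\<close>
lemma truncated_transform_cnj:
  "truncated_transform N (\<lambda>t. cnj (f t)) \<xi> = cnj (truncated_transform N f (- \<xi>))"
  unfolding fourier_integral_def
  by (subst Bochner_Integration.integral_cnj[symmetric], intro Bochner_Integration.integral_cong refl)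
    (simp add: exp_cnj truncation_def)

lemma has_fourier_transform_cnj:
  assumes "has_fourier_transform f g"
  shows "has_fourier_transform (\<lambda>t. cnj (f t)) (\<lambda>\<xi>. cnj (g (- \<xi>)))"
proof -
  have norm_eq: "L2_norm (\<lambda>\<xi>. truncated_transform N (\<lambda>t. cnj (f t)) \<xi> - cnj (g (- \<xi>))) =
      L2_norm (\<lambda>\<xi>. truncated_transform N f \<xi> - g \<xi>)" for N
  proof -
    have "L2_norm (\<lambda>\<xi>. truncated_transform N (\<lambda>t. cnj (f t)) \<xi> - cnj (g (- \<xi>))) =
        L2_norm (\<lambda>\<xi>. (\<lambda>\<xi>. truncated_transform N f \<xi> - g \<xi>) (- \<xi>))"
      unfolding truncated_transform_cnj complex_cnj_diff[symmetric] L2_norm_def complex_mod_cnj ..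
    also have "\<dots> = L2_norm (\<lambda>\<xi>. truncated_transform N f \<xi> - g \<xi>)"
      by (rule L2_norm_reflect)
    finally show ?thesis .
  qed
  show ?thesis
    using assms unfolding has_fourier_transform_iff norm_eq
    by (auto intro: square_integrable_cnj square_integrable_cnj_reflect)
qed

lemma AE_lborel_reflect:
  fixes P :: "real \<Rightarrow> bool"
  assumes "AE t in lborel. P t" shows "AE t in lborel. P (- t)"
proof -
  from assms obtain N where N: "{t \<in> space lborel. \<not> P t} \<subseteq> N" "N \<in> null_sets lborel"
    by (auto elim: AE_E simp: null_sets_def)
  then have [measurable]: "N \<in> sets borel" by (auto simp: null_sets_def)
  have "emeasure lborel ((\<lambda>t. - t) -` N \<inter> space lborel) = emeasure (distr lborel borel uminus) N"
    by (subst emeasure_distr) auto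
  also have "\<dots> = 0" using N(2) by (simp add: lborel_distr_uminus null_sets_def)
  finally have "(\<lambda>t. - t) -` N \<inter> space lborel \<in> null_sets lborel"
    by (intro null_setsI) (auto intro!: measurable_sets[of uminus lborel borel, simplified])
  then show ?thesis
    by (rule AE_I') (use N(1) in auto)
qed

lemma PW_cnj:
  assumes "f \<in> PW" shows "(\<lambda>t. cnj (f t)) \<in> PW"
proof -
  obtain g where g: "has_fourier_transform f g" "AE \<xi> in lborel. \<xi> \<notin> {-1/2..1/2} \<longrightarrow> g \<xi> = 0"
    using assms unfolding PW_def by blast
  have "AE \<xi> in lborel. \<xi> \<notin> {-1/2..1/2} \<longrightarrow> cnj (g (- \<xi>)) = 0"
    using AE_lborel_reflect[OF g(2)] by eventually_elim auto
  moreover have "continuous_on UNIV (\<lambda>t. cnj (f t))"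
    using assms by (intro continuous_intros) (auto simp: PW_def)
  ultimately show ?thesis
    using has_fourier_transform_cnj[OF g(1)] unfolding PW_def has_fourier_transform_def by blast
qed

lemma PW_Re:
  assumes "f \<in> PW" shows "(\<lambda>t. complex_of_real (Re (f t))) \<in> PW"
proof -
  have "(\<lambda>t. complex_of_real (Re (f t))) = (\<lambda>t. 1 / 2 * f t + 1 / 2 * cnj (f t))"
    by (simp add: complex_eq_iff fun_eq_iff)
  then show ?thesis by (simp only: PW_lincomb[OF assms PW_cnj[OF assms]])
qed

text \<open>
  By Parseval's identity the integral over the interval is a pairing of the transform \<open>g\<close> of \<open>f\<close> with
  the transform of an indicator function. The latter is bounded by the length \<open>2 * e\<close> of the interval, and
  \<open>g\<close> lives on a set of measure 1, so the inequality of Cauchy and Schwarz costs no further factor.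
  Parseval's identity is applied to truncations of \<open>f\<close>, which are integrable.
\<close>
lemma PW_integral_interval_le:
  assumes f: "f \<in> PW" and e: "e > 0"
  shows "cmod (LINT s|lborel. f s * indicator {t - e..t + e} s) \<le> 2 * e * L2_norm f"
proof -
  obtain g where g: "has_fourier_transform f g" "AE \<xi> in lborel. \<xi> \<notin> {-1/2..1/2} \<longrightarrow> g \<xi> = 0"
    using f unfolding PW_def by blast
  then have sq: "square_integrable f" "square_integrable g"
    and lim: "(\<lambda>N. L2_norm (\<lambda>\<xi>. truncated_transform N f \<xi> - g \<xi>)) \<longlonglongrightarrow> 0"
    by (auto simp: has_fourier_transform_iff)
  define k where "k = (indicator {t - e..t + e} :: real \<Rightarrow> complex)"
  define K where "K = (\<lambda>\<xi>. cnj (fourier_integral k \<xi>))"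
  have k: "integrable lborel k" "square_integrable k"
    unfolding k_def using e by (auto intro!: square_integrable_indicator_Icc)
  have kb: "cmod (k s) \<le> 1" for s by (simp add: k_def indicator_def)
  have kc: "AE s in lborel. isCont k s"
  proof (rule AE_I')
    show "{t - e, t + e} \<in> null_sets lborel"
      by (simp add: finite_imp_null_set_lborel)
    show "{s \<in> space lborel. \<not> isCont k s} \<subseteq> {t - e, t + e}"
    proof
      fix s assume "s \<in> {s \<in> space lborel. \<not> isCont k s}"
      moreover have "isCont k s" if "s \<notin> frontier {t - e..t + e}"
      proof -
        have "isCont (indicator {t - e..t + e} :: real \<Rightarrow> real) s"
          using that by (simp add: isCont_indicator)
        then have "isCont (\<lambda>s. complex_of_real (indicator {t - e..t + e} s)) s"
          by (intro continuous_intros)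
        also have "(\<lambda>s. complex_of_real (indicator {t - e..t + e} s)) = k"
          by (auto simp: k_def indicator_def)
        finally show ?thesis .
      qed
      ultimately have "s \<in> frontier {t - e..t + e}" by blast
      then show "s \<in> {t - e, t + e}" by (auto simp: frontier_def)
    qed
  qed
  have Ksq: "square_integrable K"
    unfolding K_def by (intro square_integrable_cnj fourier_integral_Bessel k)
  have K_bound: "cmod (K \<xi>) \<le> 2 * e" for \<xi>
  proof -
    have "cmod (K \<xi>) \<le> (LINT s|lborel. cmod (k s))"
      unfolding K_def complex_mod_cnj by (rule cmod_fourier_integral_le)
    also have "\<dots> = (LINT s|lborel. indicator {t - e..t + e} s)"
      by (intro Bochner_Integration.integral_cong refl) (simp add: k_def indicator_def)
    also have "\<dots> = 2 * e" using e by simp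
    finally show ?thesis .
  qed
  let ?J = "LINT s|lborel. f s * k s"
  let ?D = "\<lambda>N. L2_norm (\<lambda>\<xi>. truncated_transform N f \<xi> - g \<xi>)"
  have gK: "cmod (LINT \<xi>|lborel. g \<xi> * K \<xi>) \<le> 2 * e * L2_norm f"
  proof -
    \<comment> \<open>Restricting the factor \<open>K\<close> to the band leaves the product with \<open>g\<close> unchanged and makes its norm at most \<open>2 * e\<close>.\<close>
    define I where "I = (indicator {-1/2..1/2} :: real \<Rightarrow> complex)"
    have [measurable]: "K \<in> borel_measurable borel" "g \<in> borel_measurable borel"
      using Ksq sq by (auto simp: square_integrable_def)
    have [measurable]: "I \<in> borel_measurable borel" by (simp add: I_def)
    have "(\<integral>\<^sup>+\<xi>. ennreal ((cmod (I \<xi> * K \<xi>))\<^sup>2) \<partial>lborel) \<le> (\<integral>\<^sup>+\<xi>. ennreal ((2 * e)\<^sup>2) * indicator {-1/2..1/2::real} \<xi> \<partial>lborel)"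
    proof (rule nn_integral_mono)
      fix \<xi>
      have "ennreal ((cmod (K \<xi>))\<^sup>2) \<le> ennreal ((2 * e)\<^sup>2)"
        by (intro ennreal_leI power_mono K_bound) simp
      then show "ennreal ((cmod (I \<xi> * K \<xi>))\<^sup>2) \<le> ennreal ((2 * e)\<^sup>2) * indicator {-1/2..1/2::real} \<xi>"
        by (simp add: I_def indicator_def)
    qed
    also have "\<dots> = ennreal ((2 * e)\<^sup>2)"
      by (subst nn_integral_cmult_indicator) auto
    finally have IK: "(\<integral>\<^sup>+\<xi>. ennreal ((cmod (I \<xi> * K \<xi>))\<^sup>2) \<partial>lborel) \<le> ennreal ((2 * e)\<^sup>2)" .
    have IKsq: "square_integrable (\<lambda>\<xi>. I \<xi> * K \<xi>)" "L2_norm (\<lambda>\<xi>. I \<xi> * K \<xi>) \<le> 2 * e"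
      using square_integrable_nn_integralI[OF _ _ IK] e by auto
    have "(LINT \<xi>|lborel. g \<xi> * K \<xi>) = (LINT \<xi>|lborel. g \<xi> * (I \<xi> * K \<xi>))"
    proof (rule integral_cong_AE)
      show "AE \<xi> in lborel. g \<xi> * K \<xi> = g \<xi> * (I \<xi> * K \<xi>)"
        using g(2) by eventually_elim (auto simp: I_def indicator_def)
    qed measurable
    also have "cmod \<dots> \<le> L2_norm g * L2_norm (\<lambda>\<xi>. I \<xi> * K \<xi>)"
      by (rule L2_Cauchy_Schwarz(2)[OF sq(2) IKsq(1)])
    also have "\<dots> \<le> L2_norm f * (2 * e)"
      by (intro mult_mono IKsq(2) has_fourier_transform_L2_norm_le[OF g(1)]) simp_all
    finally show ?thesis by (simp add: mult.commute)
  qed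
  \<comment> \<open>From this \<open>N\<close> on, truncating \<open>f\<close> does not affect the integral over the interval.\<close>
  have bound: "cmod ?J \<le> ?D N * L2_norm K + 2 * e * L2_norm f" if N: "real N \<ge> \<bar>t\<bar> + e" for N
  proof -
    have "?J = (LINT s|lborel. truncation N f s * cnj (k s))"
      using N by (intro Bochner_Integration.integral_cong refl) (auto simp: truncation_def k_def indicator_def)
    also have "\<dots> = (LINT \<xi>|lborel. truncated_transform N f \<xi> * K \<xi>)"
      unfolding K_def by (rule fourier_integral_Parseval[symmetric, OF truncation_square_integrable(1,2)[OF sq(1)] k kb kc])
    also have "\<dots> = (LINT \<xi>|lborel. (truncated_transform N f \<xi> - g \<xi>) * K \<xi> + g \<xi> * K \<xi>)"
      by (simp add: left_diff_distrib)
    also have "\<dots> = (LINT \<xi>|lborel. (truncated_transform N f \<xi> - g \<xi>) * K \<xi>) + (LINT \<xi>|lborel. g \<xi> * K \<xi>)"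
      by (intro Bochner_Integration.integral_add L2_Cauchy_Schwarz(1) square_integrable_diff
          truncated_transform_square_integrable sq Ksq)
    finally have "cmod ?J \<le> cmod (LINT \<xi>|lborel. (truncated_transform N f \<xi> - g \<xi>) * K \<xi>) + cmod (LINT \<xi>|lborel. g \<xi> * K \<xi>)"
      by (simp only: norm_triangle_ineq)
    moreover have "cmod (LINT \<xi>|lborel. (truncated_transform N f \<xi> - g \<xi>) * K \<xi>) \<le> ?D N * L2_norm K"
      by (intro L2_Cauchy_Schwarz(2) square_integrable_diff truncated_transform_square_integrable sq Ksq)
    ultimately show ?thesis using gK by linarith
  qed
  have "(\<lambda>N. ?D N * L2_norm K + 2 * e * L2_norm f) \<longlonglongrightarrow> 0 * L2_norm K + 2 * e * L2_norm f"
    by (intro tendsto_intros lim)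
  moreover obtain N0 :: nat where "\<bar>t\<bar> + e \<le> real N0"
    using real_arch_simple by blast
  then have "\<exists>N0. \<forall>N\<ge>N0. cmod ?J \<le> ?D N * L2_norm K + 2 * e * L2_norm f"
    by (intro exI[of _ N0]) (auto intro!: bound)
  ultimately have "cmod ?J \<le> 0 * L2_norm K + 2 * e * L2_norm f"
    by (rule LIMSEQ_le_const)
  then show ?thesis by (simp add: k_def)
qed

text \<open>
  Dividing the preceding bound by the length of the interval bounds the mean of \<open>f\<close> near \<open>t\<close> by its
  norm. As the interval shrinks, the mean tends to \<open>f t\<close> by continuity.
\<close>
lemma PW_pointwise_le_L2_norm:
  assumes f: "f \<in> PW"
  shows "cmod (f t) \<le> L2_norm f"
proof (rule field_le_epsilon)
  fix \<eta> :: real assume \<eta>: "\<eta> > 0"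
  have cont: "isCont f t" and sq: "square_integrable f"
    using f by (auto simp: PW_def continuous_on_eq_continuous_at)
  then obtain d where d: "d > 0" "\<And>s. dist s t < d \<Longrightarrow> dist (f s) (f t) < \<eta>"
    using \<eta> unfolding continuous_at_eps_delta by blast
  define e where "e = d / 2"
  have e: "e > 0" using d by (simp add: e_def)
  let ?k = "indicator {t - e..t + e} :: real \<Rightarrow> complex"
  have k: "square_integrable ?k" "integrable lborel ?k"
    using e by (auto intro!: square_integrable_indicator_Icc)
  have fk: "integrable lborel (\<lambda>s. f s * ?k s)"
    by (rule L2_Cauchy_Schwarz(1)[OF sq k(1)])
  have ftk: "integrable lborel (\<lambda>s. f t * ?k s)"
    using k(2) by simp
  have "(LINT s|lborel. ?k s) = complex_of_real (LINT s|lborel. indicator {t - e..t + e} s)"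
    unfolding integral_complex_of_real[symmetric]
    by (intro Bochner_Integration.integral_cong refl) (simp add: indicator_def)
  also have "\<dots> = complex_of_real (2 * e)" using e by simp
  finally have "f t * complex_of_real (2 * e) = (LINT s|lborel. f t * ?k s)"
    by simp
  also have "\<dots> = (LINT s|lborel. f s * ?k s) + (LINT s|lborel. f t * ?k s - f s * ?k s)"
    using fk ftk by simp
  finally have "cmod (f t * complex_of_real (2 * e)) \<le>
      cmod (LINT s|lborel. f s * ?k s) + cmod (LINT s|lborel. f t * ?k s - f s * ?k s)"
    by (simp only: norm_triangle_ineq)
  also have "cmod (f t * complex_of_real (2 * e)) = cmod (f t) * (2 * e)"
    using e by (simp add: norm_mult)
  also have "cmod (LINT s|lborel. f s * ?k s) \<le> 2 * e * L2_norm f"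
    by (rule PW_integral_interval_le[OF f e])
  also have "cmod (LINT s|lborel. f t * ?k s - f s * ?k s) \<le> (LINT s|lborel. \<eta> * indicator {t - e..t + e} s)"
  proof (rule Bochner_Integration.integral_norm_bound_integral)
    show "integrable lborel (\<lambda>s. \<eta> * indicator {t - e..t + e} s)"
      using e by (simp add: integrable_indicator_iff)
    show "norm (f t * ?k s - f s * ?k s) \<le> \<eta> * indicator {t - e..t + e} s" for s
    proof (cases "s \<in> {t - e..t + e}")
      case True
      then have "dist (f s) (f t) < \<eta>"
        using e by (intro d) (auto simp: e_def dist_real_def)
      then show ?thesis using True by (simp add: dist_norm norm_minus_commute)
    qed simp
  qed (use fk ftk in simp)
  also have "(LINT s|lborel. \<eta> * indicator {t - e..t + e} s) = \<eta> * (2 * e)"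
    using e by simp
  finally have "cmod (f t) * (2 * e) \<le> (L2_norm f + \<eta>) * (2 * e)"
    by (simp add: algebra_simps)
  then show "cmod (f t) \<le> L2_norm f + \<eta>"
    using e by simp
qed

text \<open>
  The limit \<open>f\<close> is the uniform limit of the \<open>F n\<close>, hence continuous, and by Fatou's lemma also their limit
  in norm. The transforms \<open>G n\<close> converge to some \<open>g\<close> supported in the band. That \<open>g\<close> is the transform of \<open>f\<close>
  follows by comparing both with \<open>F n\<close> and \<open>G n\<close> for one good \<open>n\<close>: truncated transforms do not increase
  distances.
\<close>
lemma PW_complete:
  assumes F: "\<And>n. F n \<in> PW" and cau: "L2_Cauchy F"
  obtains f where "f \<in> PW" "(\<lambda>n. L2_norm (\<lambda>t. F n t - f t)) \<longlonglongrightarrow> 0"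
proof -
  have sqF: "square_integrable (F n)" for n using F by (rule PW_square_integrable)
  have cauD: "\<exists>M. \<forall>m\<ge>M. \<forall>n\<ge>M. L2_norm (\<lambda>t. F m t - F n t) < e" if "e > 0" for e
    using cau that unfolding L2_Cauchy_def by blast
  have "\<forall>n. \<exists>g. has_fourier_transform (F n) g \<and> (AE \<xi> in lborel. \<xi> \<notin> {-1/2..1/2} \<longrightarrow> g \<xi> = 0)"
    using F unfolding PW_def by blast
  then obtain G where G: "\<And>n. has_fourier_transform (F n) (G n)"
      "\<And>n. AE \<xi> in lborel. \<xi> \<notin> {-1/2..1/2} \<longrightarrow> G n \<xi> = 0"
    by metis
  have sqG: "square_integrable (G n)" for n using G(1)[of n] by (simp add: has_fourier_transform_def)
  have GF: "L2_norm (\<lambda>t. G m t - G n t) \<le> L2_norm (\<lambda>t. F m t - F n t)" for m n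
    using has_fourier_transform_L2_norm_le[OF has_fourier_transform_lincomb[OF G(1)[of m] G(1)[of n], of 1 "-1"]]
    by simp
  have "L2_Cauchy G"
    unfolding L2_Cauchy_def using sqG cauD GF by (meson le_less_trans)
  then obtain g r where g: "square_integrable g" "(\<lambda>n. L2_norm (\<lambda>t. G n t - g t)) \<longlonglongrightarrow> 0"
      "AE t in lborel. (\<lambda>k. G (r k) t) \<longlonglongrightarrow> g t"
    by (rule L2_complete)
  have gsupp: "AE \<xi> in lborel. \<xi> \<notin> {-1/2..1/2} \<longrightarrow> g \<xi> = 0"
  proof -
    have "AE \<xi> in lborel. \<forall>n. \<xi> \<notin> {-1/2..1/2} \<longrightarrow> G n \<xi> = 0"
      unfolding AE_all_countable using G(2) by blast
    then show ?thesis using g(3)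
    proof eventually_elim
      case (elim \<xi>)
      show ?case
      proof
        assume "\<xi> \<notin> {-1/2..1/2}"
        then have "(\<lambda>k. G (r k) \<xi>) = (\<lambda>k. 0)" using elim(1) by blast
        then show "g \<xi> = 0" using elim(2) by (simp add: LIMSEQ_const_iff)
      qed
    qed
  qed
  have "uniformly_Cauchy_on UNIV F"
  proof (rule uniformly_Cauchy_onI)
    fix e :: real assume "e > 0"
    then obtain M where M: "\<And>m n. m \<ge> M \<Longrightarrow> n \<ge> M \<Longrightarrow> L2_norm (\<lambda>t. F m t - F n t) < e"
      using cauD by blast
    have "dist (F m t) (F n t) < e" if "m \<ge> M" "n \<ge> M" for m n t
      using PW_pointwise_le_L2_norm[OF PW_diff[OF F[of m] F[of n]], of t] M[OF that] by (simp add: dist_norm)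
    then show "\<exists>M. \<forall>t\<in>UNIV. \<forall>m\<ge>M. \<forall>n\<ge>M. dist (F m t) (F n t) < e" by blast
  qed
  then obtain f where f: "uniform_limit UNIV F f sequentially"
    using Cauchy_uniformly_convergent unfolding uniformly_convergent_on_def by blast
  have cont: "continuous_on UNIV f"
    by (rule uniform_limit_theorem[OF _ f]) (use F in \<open>auto simp: PW_def\<close>)
  then have [measurable]: "f \<in> borel_measurable borel"
    by (rule borel_measurable_continuous_onI)
  have [measurable]: "F n \<in> borel_measurable borel" for n
    using sqF[of n] by (simp add: square_integrable_def)
  have lim: "(\<lambda>n. F n t) \<longlonglongrightarrow> f t" for t
    using tendsto_uniform_limitI[OF f, of t] by simp
  have tail: "\<exists>M. \<forall>n\<ge>M. square_integrable (\<lambda>t. F n t - f t) \<and> L2_norm (\<lambda>t. F n t - f t) \<le> e" if "e > 0" for e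
  proof -
    obtain M where M: "\<And>m n. m \<ge> M \<Longrightarrow> n \<ge> M \<Longrightarrow> L2_norm (\<lambda>t. F m t - F n t) < e"
      using cauD[OF \<open>e > 0\<close>] by blast
    have "square_integrable (\<lambda>t. F n t - f t) \<and> L2_norm (\<lambda>t. F n t - f t) \<le> e" if "n \<ge> M" for n
    proof -
      have "AE t in lborel. (\<lambda>k. F n t - F k t) \<longlonglongrightarrow> F n t - f t"
        by (intro AE_I2 tendsto_intros lim)
      moreover have "eventually (\<lambda>k. L2_norm (\<lambda>t. F n t - F k t) \<le> e) sequentially"
        using eventually_ge_at_top[of M] by eventually_elim (rule less_imp_le[OF M[OF \<open>n \<ge> M\<close>]])
      ultimately show ?thesis
        using L2_norm_le_Fatou[of "\<lambda>k t. F n t - F k t" "\<lambda>t. F n t - f t" e]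
          square_integrable_diff[OF sqF sqF] \<open>e > 0\<close> by auto
    qed
    then show ?thesis by blast
  qed
  obtain n0 where "square_integrable (\<lambda>t. F n0 t - f t)"
    using tail[of 1] by auto
  from square_integrable_diff[OF sqF[of n0] this] have sqf: "square_integrable f" by simp
  have Ff: "(\<lambda>n. L2_norm (\<lambda>t. F n t - f t)) \<longlonglongrightarrow> 0"
  proof (rule LIMSEQ_I)
    fix e :: real assume "e > 0"
    then obtain M where "\<forall>n\<ge>M. L2_norm (\<lambda>t. F n t - f t) \<le> e / 2"
      using tail[of "e / 2"] by auto
    then show "\<exists>M. \<forall>n\<ge>M. norm (L2_norm (\<lambda>t. F n t - f t) - 0) < e"
      using \<open>e > 0\<close> by (intro exI[of _ M]) fastforce
  qed
  have "has_fourier_transform f g"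
    unfolding has_fourier_transform_iff
  proof (intro conjI sqf g(1) LIMSEQ_I)
    fix e :: real assume "e > 0"
    have three: "L2_norm (\<lambda>\<xi>. truncated_transform N f \<xi> - g \<xi>) \<le> L2_norm (\<lambda>t. F n t - f t) +
        (L2_norm (\<lambda>\<xi>. truncated_transform N (F n) \<xi> - G n \<xi>) + L2_norm (\<lambda>\<xi>. G n \<xi> - g \<xi>))" for N n
    proof -
      note tt = truncated_transform_square_integrable(1)
      have a: "L2_norm (\<lambda>\<xi>. truncated_transform N f \<xi> - truncated_transform N (F n) \<xi>) \<le> L2_norm (\<lambda>t. F n t - f t)"
      proof -
        have "(\<lambda>\<xi>. truncated_transform N f \<xi> - truncated_transform N (F n) \<xi>) = truncated_transform N (\<lambda>t. f t - F n t)"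
          using truncated_transform_lincomb[OF sqf sqF[of n], of N 1 "-1"] by auto
        then show ?thesis
          using truncated_transform_square_integrable(2)[OF square_integrable_diff[OF sqf sqF[of n]], of N]
          by (simp add: L2_norm_minus_commute[of f])
      qed
      have "L2_norm (\<lambda>\<xi>. (truncated_transform N f \<xi> - truncated_transform N (F n) \<xi>) +
            ((truncated_transform N (F n) \<xi> - G n \<xi>) + (G n \<xi> - g \<xi>))) \<le>
          L2_norm (\<lambda>\<xi>. truncated_transform N f \<xi> - truncated_transform N (F n) \<xi>) +
          L2_norm (\<lambda>\<xi>. (truncated_transform N (F n) \<xi> - G n \<xi>) + (G n \<xi> - g \<xi>))"
        by (intro square_integrable_add square_integrable_diff tt sqf sqF sqG g(1))
      also have "L2_norm (\<lambda>\<xi>. (truncated_transform N (F n) \<xi> - G n \<xi>) + (G n \<xi> - g \<xi>)) \<le>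
          L2_norm (\<lambda>\<xi>. truncated_transform N (F n) \<xi> - G n \<xi>) + L2_norm (\<lambda>\<xi>. G n \<xi> - g \<xi>)"
        by (intro square_integrable_add square_integrable_diff tt sqf sqF sqG g(1))
      finally show ?thesis using a by simp
    qed
    have ev: "eventually (\<lambda>n. L2_norm (\<lambda>t. F n t - f t) < e / 3 \<and> L2_norm (\<lambda>\<xi>. G n \<xi> - g \<xi>) < e / 3) sequentially"
      using order_tendstoD(2)[OF Ff, of "e / 3"] order_tendstoD(2)[OF g(2), of "e / 3"] \<open>e > 0\<close>
      by (simp add: eventually_conj_iff)
    then obtain n where n: "L2_norm (\<lambda>t. F n t - f t) < e / 3" "L2_norm (\<lambda>\<xi>. G n \<xi> - g \<xi>) < e / 3"
      using eventually_happens'[OF sequentially_bot ev] by blast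
    have "(\<lambda>N. L2_norm (\<lambda>\<xi>. truncated_transform N (F n) \<xi> - G n \<xi>)) \<longlonglongrightarrow> 0"
      using G(1)[of n] by (simp add: has_fourier_transform_iff)
    from order_tendstoD(2)[OF this, of "e / 3"] \<open>e > 0\<close>
    obtain N0 where N0: "\<And>N. N \<ge> N0 \<Longrightarrow> L2_norm (\<lambda>\<xi>. truncated_transform N (F n) \<xi> - G n \<xi>) < e / 3"
      by (auto simp: eventually_sequentially)
    show "\<exists>N0. \<forall>N\<ge>N0. norm (L2_norm (\<lambda>\<xi>. truncated_transform N f \<xi> - g \<xi>) - 0) < e"
    proof (intro exI[of _ N0] allI impI)
      fix N assume "N \<ge> N0"
      from three[of N n] N0[OF this] n show "norm (L2_norm (\<lambda>\<xi>. truncated_transform N f \<xi> - g \<xi>) - 0) < e"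
        by simp
    qed
  qed
  then have "f \<in> PW"
    using cont sqf gsupp unfolding PW_def by blast
  then show thesis using that Ff by blast
qed

section \<open>Nearest points in spaces of square summable sequences\<close>

lemma ell2_norm_nonneg [simp]: "0 \<le> ell2_norm a"
  by (simp add: ell2_norm_def infsum_nonneg)

lemma ell2_norm_power2: "(ell2_norm a)\<^sup>2 = (\<Sum>\<^sub>\<infinity>k. (cmod (a k))\<^sup>2)"
  by (simp add: ell2_norm_def infsum_nonneg)

lemma ell2_norm_minus_commute: "ell2_norm (\<lambda>k. a k - b k) = ell2_norm (\<lambda>k. b k - a k)"
  by (simp add: ell2_norm_def norm_minus_commute)

lemma ell2_cmult:
  assumes "a \<in> ell2"
  shows "(\<lambda>k. c * a k) \<in> ell2" and "ell2_norm (\<lambda>k. c * a k) = cmod c * ell2_norm a"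
  using assms by (simp_all add: ell2_def ell2_norm_def norm_mult power_mult_distrib
      summable_on_cmult_right infsum_cmult_right' real_sqrt_mult)

lemma ell2_norm_mono:
  assumes "b \<in> ell2" "\<And>k. cmod (a k) \<le> cmod (b k)"
  shows "a \<in> ell2" and "ell2_norm a \<le> ell2_norm b"
proof -
  have le: "(cmod (a k))\<^sup>2 \<le> (cmod (b k))\<^sup>2" for k
    using assms(2) by (intro power_mono) auto
  have b: "(\<lambda>k. (cmod (b k))\<^sup>2) summable_on UNIV" using assms(1) by (simp add: ell2_def)
  have a: "(\<lambda>k. (cmod (a k))\<^sup>2) summable_on UNIV"
    by (rule summable_on_comparison_test[OF b]) (use le in auto)
  then show "a \<in> ell2" by (simp add: ell2_def)
  show "ell2_norm a \<le> ell2_norm b"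
    unfolding ell2_norm_def by (intro real_sqrt_le_mono infsum_mono a b le)
qed

lemma ell2_norm_triangle:
  assumes "(\<lambda>k. a k - b k) \<in> ell2" "(\<lambda>k. b k - c k) \<in> ell2"
  shows "ell2_norm (\<lambda>k. a k - c k) \<le> ell2_norm (\<lambda>k. a k - b k) + ell2_norm (\<lambda>k. b k - c k)"
  using ell2_add(2)[OF assms] by simp

lemma cmod_le_ell2_norm:
  assumes "a \<in> ell2" shows "cmod (a k) \<le> ell2_norm a"
proof -
  have "(\<Sum>i\<in>{k}. (cmod (a i))\<^sup>2) \<le> (\<Sum>\<^sub>\<infinity>i. (cmod (a i))\<^sup>2)"
    using assms by (intro finite_sum_le_infsum) (auto simp: ell2_def)
  then show ?thesis
    using power2_le_imp_le[of "cmod (a k)" "ell2_norm a"] by (simp add: ell2_norm_power2)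
qed

lemma ell2_parallelogram:
  assumes a: "a \<in> ell2" and b: "b \<in> ell2"
  shows "(ell2_norm (\<lambda>k. a k + b k))\<^sup>2 + (ell2_norm (\<lambda>k. a k - b k))\<^sup>2 = 2 * (ell2_norm a)\<^sup>2 + 2 * (ell2_norm b)\<^sup>2"
proof -
  have s: "(\<lambda>k. (cmod (c k))\<^sup>2) summable_on UNIV" if "c \<in> ell2" for c
    using that by (simp add: ell2_def)
  have pt: "(cmod (u + v))\<^sup>2 + (cmod (u - v))\<^sup>2 = 2 * (cmod u)\<^sup>2 + 2 * (cmod v)\<^sup>2" for u v
    by (simp add: cmod_power2 power2_sum power2_diff)
  show ?thesis
    unfolding ell2_norm_power2
    using s[OF ell2_add(1)[OF a b]] s[OF ell2_diff[OF a b]] s[OF a] s[OF b]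
    by (simp add: infsum_add[symmetric] infsum_cmult_right'[symmetric] summable_on_cmult_right pt)
qed

lemma ell2_inner_summable:
  assumes a: "a \<in> ell2" and b: "b \<in> ell2"
  shows "(\<lambda>k. a k * cnj (b k)) summable_on UNIV"
proof (rule abs_summable_summable, rule summable_on_comparison_test)
  show "(\<lambda>k. (cmod (a k))\<^sup>2 + (cmod (b k))\<^sup>2) summable_on UNIV"
    using a b by (intro summable_on_add) (simp_all add: ell2_def)
  show "norm (a k * cnj (b k)) \<le> (cmod (a k))\<^sup>2 + (cmod (b k))\<^sup>2" for k
  proof -
    have "0 \<le> (cmod (a k) - cmod (b k))\<^sup>2" by simp
    then have "2 * (cmod (a k) * cmod (b k)) \<le> (cmod (a k))\<^sup>2 + (cmod (b k))\<^sup>2"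
      by (simp add: power2_diff)
    moreover have "0 \<le> cmod (a k) * cmod (b k)" by simp
    ultimately have "cmod (a k) * cmod (b k) \<le> (cmod (a k))\<^sup>2 + (cmod (b k))\<^sup>2" by linarith
    then show ?thesis by (simp add: norm_mult)
  qed
qed auto

lemma ell2_norm_diff_cmult_power2:
  assumes a: "a \<in> ell2" and b: "b \<in> ell2"
  shows "(ell2_norm (\<lambda>k. a k - c * b k))\<^sup>2 =
    (ell2_norm a)\<^sup>2 - 2 * Re (cnj c * ell2_inner a b) + (cmod c)\<^sup>2 * (ell2_norm b)\<^sup>2"
proof -
  have pt: "(cmod (u - c * v))\<^sup>2 = (cmod u)\<^sup>2 + ((- 2) * Re (cnj c * (u * cnj v)) + (cmod c)\<^sup>2 * (cmod v)\<^sup>2)" for u v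
    unfolding cmod_power2 by (simp add: power2_eq_square algebra_simps)
  have i: "(\<lambda>k. cnj c * (a k * cnj (b k))) summable_on UNIV"
    by (intro summable_on_cmult_right ell2_inner_summable a b)
  have s: "(\<lambda>k. (cmod (a k))\<^sup>2) summable_on UNIV" "(\<lambda>k. (cmod (b k))\<^sup>2) summable_on UNIV"
    using a b by (simp_all add: ell2_def)
  have "(\<Sum>\<^sub>\<infinity>k. (cmod (a k - c * b k))\<^sup>2) = (\<Sum>\<^sub>\<infinity>k. (cmod (a k))\<^sup>2) +
      ((\<Sum>\<^sub>\<infinity>k. (- 2) * Re (cnj c * (a k * cnj (b k)))) + (\<Sum>\<^sub>\<infinity>k. (cmod c)\<^sup>2 * (cmod (b k))\<^sup>2))"
    unfolding pt using s summable_on_Re[OF i]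
    by (simp only: infsum_add summable_on_add summable_on_cmult_right)
  then show ?thesis
    unfolding ell2_norm_power2 ell2_inner_def infsum_cmult_right' infsum_Re[OF i] by simp
qed

text \<open>
  If the inner product \<open>w\<close> did not vanish, moving \<open>v\<close> by a small multiple of \<open>w * r\<close> would shorten it.
\<close>
lemma nearest_point_orthogonal:
  assumes v: "v \<in> ell2" and r: "r \<in> ell2"
    and min: "\<And>c. ell2_norm v \<le> ell2_norm (\<lambda>k. v k - c * r k)"
  shows "ell2_inner v r = 0"
proof (rule ccontr)
  assume nz: "ell2_inner v r \<noteq> 0"
  let ?w = "ell2_inner v r" and ?N = "(ell2_norm r)\<^sup>2 + 1"
  \<comment> \<open>With this \<open>t\<close> the quadratic term is at most half of the linear one; the summand 1 avoids a case distinction on \<open>r = 0\<close>.\<close>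
  define t where "t = 1 / ?N"
  have N: "?N > 0" by (smt (verit) zero_le_power2)
  then have t: "t > 0" "t * (ell2_norm r)\<^sup>2 \<le> 1" by (auto simp: t_def field_simps)
  have "(ell2_norm v)\<^sup>2 \<le> (ell2_norm (\<lambda>k. v k - (complex_of_real t * ?w) * r k))\<^sup>2"
    by (intro power_mono min) simp
  also have "\<dots> = (ell2_norm v)\<^sup>2 - 2 * t * (cmod ?w)\<^sup>2 + (t * (cmod ?w)\<^sup>2) * (t * (ell2_norm r)\<^sup>2)"
  proof -
    have "Re (cnj (complex_of_real t * ?w) * ?w) = t * (cmod ?w)\<^sup>2"
      unfolding cmod_power2 by (simp add: power2_eq_square algebra_simps)
    moreover have "(cmod (complex_of_real t * ?w))\<^sup>2 = t\<^sup>2 * (cmod ?w)\<^sup>2"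
      by (simp add: norm_mult power_mult_distrib)
    ultimately show ?thesis
      unfolding ell2_norm_diff_cmult_power2[OF v r] by (simp add: power2_eq_square)
  qed
  also have "(t * (cmod ?w)\<^sup>2) * (t * (ell2_norm r)\<^sup>2) \<le> t * (cmod ?w)\<^sup>2"
    using t by (intro mult_left_le) auto
  finally have "t * (cmod ?w)\<^sup>2 \<le> 0" by linarith
  moreover have "t * (cmod ?w)\<^sup>2 > 0" using t nz by simp
  ultimately show False by linarith
qed

lemma ell2_inner_self_eq_0:
  assumes a: "a \<in> ell2" and "ell2_inner a a = 0"
  shows "a k = 0"
proof -
  have "(\<lambda>k. a k - 1 * a k) = (\<lambda>k. 0)" by simp
  then have "(ell2_norm (\<lambda>k. a k - 1 * a k))\<^sup>2 = 0" by (simp add: ell2_norm_def)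
  then have "ell2_norm a = 0"
    unfolding ell2_norm_diff_cmult_power2[OF a a] assms(2) by simp
  then show ?thesis using cmod_le_ell2_norm[OF a, of k] by simp
qed

text \<open>
  A nearest point satisfies the orthogonality condition in the definition of \<^const>\<open>orth_proj\<close>. Two points
  that satisfy it differ by an element of \<open>R\<close> orthogonal to itself.
\<close>
lemma orth_proj_eq_nearest_point:
  assumes R: "R \<subseteq> ell2" and lin: "\<And>u v c. u \<in> R \<Longrightarrow> v \<in> R \<Longrightarrow> (\<lambda>k. u k + c * v k) \<in> R"
    and a: "a \<in> ell2" and p: "p \<in> R"
    and min: "\<And>r. r \<in> R \<Longrightarrow> ell2_norm (\<lambda>k. a k - p k) \<le> ell2_norm (\<lambda>k. a k - r k)"
  shows "orth_proj R a = p"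
  unfolding orth_proj_def
proof (rule the_equality)
  have orth: "ell2_inner (\<lambda>k. a k - p k) r = 0" if r: "r \<in> R" for r
  proof (rule nearest_point_orthogonal)
    show "(\<lambda>k. a k - p k) \<in> ell2" "r \<in> ell2" using a p r R ell2_diff by auto
    show "ell2_norm (\<lambda>k. a k - p k) \<le> ell2_norm (\<lambda>k. a k - p k - c * r k)" for c
      using min[OF lin[OF p r, of c]] by (simp add: diff_diff_eq)
  qed
  then show "p \<in> R \<and> (\<forall>r\<in>R. ell2_inner (\<lambda>k. a k - p k) r = 0)" using p by blast
  fix q assume q: "q \<in> R \<and> (\<forall>r\<in>R. ell2_inner (\<lambda>k. a k - q k) r = 0)"
  define d where "d = (\<lambda>k. p k - q k)"
  have d: "d \<in> R" using lin[of p q "-1"] p q by (simp add: d_def)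
  have el: "(\<lambda>k. a k - q k) \<in> ell2" "(\<lambda>k. a k - p k) \<in> ell2" "d \<in> ell2"
    using a p q R d by (auto intro!: ell2_diff)
  have "ell2_inner (\<lambda>k. a k - q k) d = (\<Sum>\<^sub>\<infinity>k. (a k - p k) * cnj (d k) + d k * cnj (d k))"
    unfolding ell2_inner_def by (intro infsum_cong) (simp add: d_def algebra_simps)
  also have "\<dots> = ell2_inner (\<lambda>k. a k - p k) d + ell2_inner d d"
    unfolding ell2_inner_def by (intro infsum_add ell2_inner_summable el)
  finally have "ell2_inner d d = 0" using orth[OF d] q d by simp
  then have "d k = 0" for k using ell2_inner_self_eq_0[OF el(3)] by blast
  then show "q = p" by (auto simp: d_def)
qed

section \<open>The projection onto the range of the sampling operator\<close>

lemma sampling_set_bounds: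
  assumes "sampling_set x"
  obtains A B where "0 < A" "0 < B" "\<And>f. f \<in> PW \<Longrightarrow> sample x f \<in> ell2"
    "\<And>f. f \<in> PW \<Longrightarrow> A * L2_norm f \<le> ell2_norm (sample x f)"
    "\<And>f. f \<in> PW \<Longrightarrow> ell2_norm (sample x f) \<le> B * L2_norm f"
proof -
  from assms obtain A B where AB: "0 < A" "A \<le> B"
    and *: "\<And>f. f \<in> PW \<Longrightarrow> sample x f \<in> ell2 \<and>
                A * (L2_norm f)\<^sup>2 \<le> (\<Sum>\<^sub>\<infinity>k. (cmod (f (x k)))\<^sup>2) \<and>
                (\<Sum>\<^sub>\<infinity>k. (cmod (f (x k)))\<^sup>2) \<le> B * (L2_norm f)\<^sup>2"
    unfolding sampling_set_def by blast
  show thesis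
  proof
    show "0 < sqrt A" "0 < sqrt B" using AB by auto
    fix f assume f: "f \<in> PW"
    show "sample x f \<in> ell2" using *[OF f] by blast
    have "sqrt (A * (L2_norm f)\<^sup>2) \<le> ell2_norm (sample x f)"
      unfolding ell2_norm_def sample_def using *[OF f] by (intro real_sqrt_le_mono) blast
    then show "sqrt A * L2_norm f \<le> ell2_norm (sample x f)" by (simp add: real_sqrt_mult)
    have "ell2_norm (sample x f) \<le> sqrt (B * (L2_norm f)\<^sup>2)"
      unfolding ell2_norm_def sample_def using *[OF f] by (intro real_sqrt_le_mono) blast
    then show "ell2_norm (sample x f) \<le> sqrt B * L2_norm f" by (simp add: real_sqrt_mult)
  qed
qed

lemma zero_in_PW: "(\<lambda>t. 0) \<in> PW"
proof -
  have "square_integrable (\<lambda>t. 0)" by (simp add: square_integrable_def)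
  moreover have "has_fourier_transform (\<lambda>t. 0) (\<lambda>\<xi>. 0)"
    by (simp add: has_fourier_transform_def square_integrable_def fourier_integral_def cong: if_cong)
  ultimately show ?thesis unfolding PW_def by auto
qed

lemma sample_diff: "(\<lambda>k. sample x f k - sample x g k) = sample x (\<lambda>t. f t - g t)"
  by (simp add: sample_def)

text \<open>
  Take signals whose samples minimize the distance to \<open>a\<close>. The midpoint of two of these sample
  sequences is again a sample sequence, so the parallelogram law bounds their distance. The lower
  sampling bound makes the signals Cauchy, \<open>PW_complete\<close> gives a limit, and the upper sampling bound
  shows that it attains the infimum.
\<close>
lemma sample_nearest_point_exists:
  assumes x: "sampling_set x" and a: "a \<in> ell2"
  obtains f where "f \<in> PW"
    "\<And>g. g \<in> PW \<Longrightarrow> ell2_norm (\<lambda>k. a k - sample x f k) \<le> ell2_norm (\<lambda>k. a k - sample x g k)"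
proof -
  obtain A B where AB: "0 < A" "0 < B" and S: "\<And>f. f \<in> PW \<Longrightarrow> sample x f \<in> ell2"
    and lower: "\<And>f. f \<in> PW \<Longrightarrow> A * L2_norm f \<le> ell2_norm (sample x f)"
    and upper: "\<And>f. f \<in> PW \<Longrightarrow> ell2_norm (sample x f) \<le> B * L2_norm f"
    using sampling_set_bounds[OF x] by blast
  define D where "D f = (ell2_norm (\<lambda>k. a k - sample x f k))\<^sup>2" for f
  define d where "d = (INF f\<in>PW. D f)"
  have bdd: "bdd_below (D ` PW)" by (intro bdd_belowI[of _ 0]) (auto simp: D_def)
  have d_le: "d \<le> D f" if "f \<in> PW" for f
    unfolding d_def by (rule cINF_lower[OF bdd that])
  have d0: "0 \<le> d" unfolding d_def by (rule cINF_greatest) (use zero_in_PW in \<open>auto simp: D_def\<close>)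
  have "\<exists>f\<in>PW. D f < d + 1 / real (Suc n)" for n
    using cINF_less_iff[OF _ bdd, of "d + 1 / real (Suc n)"] zero_in_PW unfolding d_def[symmetric] by auto
  then obtain F where F: "\<And>n. F n \<in> PW" "\<And>n. D (F n) < d + 1 / real (Suc n)" by metis
  have aS: "(\<lambda>k. a k - sample x f k) \<in> ell2" if "f \<in> PW" for f
    by (rule ell2_diff[OF a S[OF that]])
  have close: "(ell2_norm (sample x (\<lambda>t. F m t - F n t)))\<^sup>2 \<le> 2 / real (Suc m) + 2 / real (Suc n)" for m n
  proof -
    define h where "h = (\<lambda>t. 1 / 2 * F m t + 1 / 2 * F n t)"
    have h: "h \<in> PW" unfolding h_def by (rule PW_lincomb[OF F(1) F(1)])
    have "(\<lambda>k. (a k - sample x (F m) k) + (a k - sample x (F n) k)) = (\<lambda>k. 2 * (a k - sample x h k))"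
      by (simp add: h_def sample_def fun_eq_iff)
    then have plus: "(ell2_norm (\<lambda>k. (a k - sample x (F m) k) + (a k - sample x (F n) k)))\<^sup>2 = 4 * D h"
      using ell2_cmult(2)[OF aS[OF h], of 2] by (simp add: D_def power_mult_distrib)
    have "(ell2_norm (\<lambda>k. (a k - sample x (F m) k) - (a k - sample x (F n) k)))\<^sup>2 =
        (ell2_norm (\<lambda>k. sample x (F n) k - sample x (F m) k))\<^sup>2" by simp
    also have "\<dots> = (ell2_norm (sample x (\<lambda>t. F m t - F n t)))\<^sup>2"
      by (subst ell2_norm_minus_commute) (simp only: sample_diff)
    finally have "4 * D h + (ell2_norm (sample x (\<lambda>t. F m t - F n t)))\<^sup>2 = 2 * D (F m) + 2 * D (F n)"
      using ell2_parallelogram[OF aS[OF F(1)[of m]] aS[OF F(1)[of n]]] plus by (simp add: D_def)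
    moreover have "2 * D (F m) < 2 * d + 2 / real (Suc m)" "2 * D (F n) < 2 * d + 2 / real (Suc n)"
      using F(2)[of m] F(2)[of n] by linarith+
    ultimately show ?thesis using d_le[OF h] by linarith
  qed
  have "L2_Cauchy F"
    unfolding L2_Cauchy_def
  proof (intro conjI allI impI)
    show "square_integrable (F n)" for n using F(1) by (rule PW_square_integrable)
    fix e :: real assume e: "e > 0"
    then have "(A * e)\<^sup>2 / 4 > 0" using AB by simp
    then obtain M where M: "1 / real (Suc M) < (A * e)\<^sup>2 / 4" by (rule nat_approx_posE)
    have inv: "1 / real (Suc n) < (A * e)\<^sup>2 / 4" if "n \<ge> M" for n
    proof -
      have "1 / real (Suc n) \<le> 1 / real (Suc M)" using that by (intro divide_left_mono) auto
      then show ?thesis using M by linarith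
    qed
    have "L2_norm (\<lambda>t. F m t - F n t) < e" if "m \<ge> M" "n \<ge> M" for m n
    proof -
      have "(ell2_norm (sample x (\<lambda>t. F m t - F n t)))\<^sup>2 < (A * e)\<^sup>2"
        using close[of m n] inv[OF that(1)] inv[OF that(2)] by linarith
      then have "ell2_norm (sample x (\<lambda>t. F m t - F n t)) < A * e"
        by (rule power_less_imp_less_base) (use AB e in simp)
      then have "A * L2_norm (\<lambda>t. F m t - F n t) < A * e"
        using lower[OF PW_diff[OF F(1)[of m] F(1)[of n]]] by linarith
      then show ?thesis using AB by simp
    qed
    then show "\<exists>M. \<forall>m\<ge>M. \<forall>n\<ge>M. L2_norm (\<lambda>t. F m t - F n t) < e" by blast
  qed
  then obtain f where f: "f \<in> PW" "(\<lambda>n. L2_norm (\<lambda>t. F n t - f t)) \<longlonglongrightarrow> 0"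
    using PW_complete[of F, OF F(1)] by blast
  have "ell2_norm (\<lambda>k. a k - sample x f k) \<le> sqrt (d + 1 / real (Suc n)) + B * L2_norm (\<lambda>t. F n t - f t)" for n
  proof -
    have "ell2_norm (\<lambda>k. a k - sample x f k) \<le>
        ell2_norm (\<lambda>k. a k - sample x (F n) k) + ell2_norm (\<lambda>k. sample x (F n) k - sample x f k)"
      by (intro ell2_norm_triangle ell2_diff a S F f)
    also have "ell2_norm (\<lambda>k. a k - sample x (F n) k) \<le> sqrt (d + 1 / real (Suc n))"
      using F(2)[of n] by (intro real_le_rsqrt) (simp add: D_def)
    also have "ell2_norm (\<lambda>k. sample x (F n) k - sample x f k) \<le> B * L2_norm (\<lambda>t. F n t - f t)"
      unfolding sample_diff by (intro upper PW_diff F f)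
    finally show ?thesis by simp
  qed
  moreover have "(\<lambda>n. sqrt (d + 1 / real (Suc n)) + B * L2_norm (\<lambda>t. F n t - f t)) \<longlonglongrightarrow> sqrt (d + 0) + B * 0"
    by (intro tendsto_intros inverse_Suc_tendsto_0 f(2))
  ultimately have "ell2_norm (\<lambda>k. a k - sample x f k) \<le> sqrt (d + 0) + B * 0"
    by (intro LIMSEQ_le_const) auto
  moreover have "sqrt d \<le> ell2_norm (\<lambda>k. a k - sample x g k)" if "g \<in> PW" for g
    using d_le[OF that] by (simp add: D_def real_le_lsqrt)
  ultimately show thesis using that[OF f(1)] by force
qed

lemma proj_sample_nearest_point:
  assumes x: "sampling_set x" and a: "a \<in> ell2"
  obtains f where "f \<in> PW" "proj_sample x a = sample x f"
    "\<And>g. g \<in> PW \<Longrightarrow> ell2_norm (\<lambda>k. a k - proj_sample x a k) \<le> ell2_norm (\<lambda>k. a k - sample x g k)"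
proof -
  obtain f where f: "f \<in> PW"
    and min: "\<And>g. g \<in> PW \<Longrightarrow> ell2_norm (\<lambda>k. a k - sample x f k) \<le> ell2_norm (\<lambda>k. a k - sample x g k)"
    using sample_nearest_point_exists[OF x a] by blast
  have "proj_sample x a = sample x f"
    unfolding proj_sample_def
  proof (rule orth_proj_eq_nearest_point[OF _ _ a])
    show "sample x ` PW \<subseteq> ell2"
      using sampling_set_bounds[OF x] by (metis image_subsetI)
    show "(\<lambda>k. u k + c * v k) \<in> sample x ` PW" if uv: "u \<in> sample x ` PW" "v \<in> sample x ` PW" for u v c
    proof -
      from uv obtain g h where g: "g \<in> PW" "u = sample x g" and h: "h \<in> PW" "v = sample x h" by blast
      have "(\<lambda>k. u k + c * v k) = sample x (\<lambda>t. 1 * g t + c * h t)"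
        using g h by (simp add: sample_def)
      then show ?thesis using PW_lincomb[OF g(1) h(1)] by blast
    qed
  qed (use f min in auto)
  then show thesis using that f min by simp
qed

lemma cINF_pos_iff:
  fixes g :: "'a \<Rightarrow> real"
  assumes "S \<noteq> {}" "\<And>n. n \<in> S \<Longrightarrow> 0 \<le> g n"
  shows "0 < (INF n\<in>S. g n) \<longleftrightarrow> (\<exists>\<delta>>0. \<forall>n\<in>S. \<delta> \<le> g n)"
proof
  have bdd: "bdd_below (g ` S)" using assms(2) by (intro bdd_belowI[of _ 0]) auto
  show "0 < (INF n\<in>S. g n) \<Longrightarrow> \<exists>\<delta>>0. \<forall>n\<in>S. \<delta> \<le> g n"
    using cINF_lower[OF bdd] by blast
  assume "\<exists>\<delta>>0. \<forall>n\<in>S. \<delta> \<le> g n"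
  then obtain \<delta> where "\<delta> > 0" "\<And>n. n \<in> S \<Longrightarrow> \<delta> \<le> g n" by blast
  then have "\<delta> \<le> (INF n\<in>S. g n)" by (intro cINF_greatest assms(1))
  with \<open>\<delta> > 0\<close> show "0 < (INF n\<in>S. g n)" by linarith
qed

text \<open>
  This replaces the projections in \<^const>\<open>Delta\<close> and \<^const>\<open>Delta_real\<close> by distances from samples, so
  that it also makes sense if the samples of \<open>V\<close> are not a complex subspace, as for real signals.
\<close>
definition separated_by_sampling :: "(int \<Rightarrow> real) \<Rightarrow> (real \<Rightarrow> complex) set \<Rightarrow> (int \<Rightarrow> complex) set \<Rightarrow> bool" where
  "separated_by_sampling x V L \<longleftrightarrow>
     (\<exists>\<delta>>0. \<forall>n\<in>L - {\<lambda>k. 0}. \<forall>f\<in>V. \<delta> \<le> ell2_norm (\<lambda>k. n k - sample x f k))"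

lemma projection_defect_pos_iff_separated:
  assumes x: "sampling_set x" and L: "L \<subseteq> ell2" "L - {\<lambda>k. 0} \<noteq> {}"
  shows "0 < (INF n\<in>L - {\<lambda>k. 0}. ell2_norm (\<lambda>k. n k - proj_sample x n k)) \<longleftrightarrow> separated_by_sampling x PW L"
proof -
  have "(\<delta> \<le> ell2_norm (\<lambda>k. n k - proj_sample x n k)) \<longleftrightarrow> (\<forall>f\<in>PW. \<delta> \<le> ell2_norm (\<lambda>k. n k - sample x f k))"
    if "n \<in> L - {\<lambda>k. 0}" for n \<delta>
  proof -
    have "n \<in> ell2" using that L by blast
    from proj_sample_nearest_point[OF x this] obtain f where "f \<in> PW" "proj_sample x n = sample x f"
      "\<And>g. g \<in> PW \<Longrightarrow> ell2_norm (\<lambda>k. n k - proj_sample x n k) \<le> ell2_norm (\<lambda>k. n k - sample x g k)"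
      by blast
    then show ?thesis by (auto intro: order_trans)
  qed
  then show ?thesis
    by (subst cINF_pos_iff[OF L(2)]) (auto simp: separated_by_sampling_def)
qed

lemma unit_sequence_in_ell2: "(\<lambda>k::int. if k = 0 then 1 else 0) \<in> ell2"
proof -
  have "(\<lambda>k. (cmod (if k = (0::int) then 1 else 0))\<^sup>2) summable_on {0}" by simp
  then have "(\<lambda>k. (cmod (if k = (0::int) then 1 else 0))\<^sup>2) summable_on UNIV"
    by (rule summable_on_cong_neutral[THEN iffD1, rotated -1]) auto
  then show ?thesis by (simp add: ell2_def)
qed

lemma Delta_pos_iff:
  assumes "sampling_set x"
  shows "Delta x > 0 \<longleftrightarrow> separated_by_sampling x PW ell2_gauss_int"
  unfolding Delta_def
proof (rule projection_defect_pos_iff_separated[OF assms])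
  have "(\<lambda>k. if k = 0 then 1 else 0) \<in> ell2_gauss_int - {\<lambda>k. 0}"
    using unit_sequence_in_ell2 by (auto simp: ell2_gauss_int_def fun_eq_iff)
  then show "ell2_gauss_int - {\<lambda>k. 0} \<noteq> {}" by blast
qed (auto simp: ell2_gauss_int_def)

lemma PW_real_subset: "PW_real \<subseteq> PW"
  by (auto simp: PW_real_def)

lemma PW_Re_in_PW_real: "f \<in> PW \<Longrightarrow> (\<lambda>t. complex_of_real (Re (f t))) \<in> PW_real"
  using PW_Re by (simp add: PW_real_def)

text \<open>
  Real values almost everywhere imply real values everywhere, by continuity: the imaginary part is a
  continuous function with vanishing norm.
\<close>
lemma PW_real_value_real:
  assumes "f \<in> PW_real" shows "f t \<in> \<real>"
proof -
  have f: "f \<in> PW" and ae: "AE t in lborel. f t \<in> \<real>"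
    using assms by (auto simp: PW_real_def)
  define h where "h = (\<lambda>t. f t - complex_of_real (Re (f t)))"
  have h: "h \<in> PW" unfolding h_def by (intro PW_diff PW_Re f)
  have "AE t in lborel. (cmod (h t))\<^sup>2 = 0"
    using ae by eventually_elim (simp add: h_def complex_is_Real_iff complex_eq_iff)
  then have "L2_norm h = 0"
    unfolding L2_norm_def by (simp add: integral_eq_zero_AE)
  then have "h t = 0"
    using h by (intro L2_norm_eq_0_continuous) (auto simp: PW_def)
  then show ?thesis by (simp add: h_def) (metis Reals_of_real)
qed

text \<open>
  The projection in \<^const>\<open>Delta_real\<close> is onto the samples of all complex signals. Only real signals matter:
  passing to the real part of \<open>f\<close> does not increase the distance from a real sequence.
\<close>
lemma Delta_real_pos_iff:
  assumes x: "sampling_set x"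
  shows "Delta_real x > 0 \<longleftrightarrow> separated_by_sampling x PW_real ell2_int"
proof -
  have "(\<lambda>k. if k = 0 then 1 else 0) \<in> ell2_int - {\<lambda>k. 0}"
    using unit_sequence_in_ell2 by (auto simp: ell2_int_def fun_eq_iff)
  then have "ell2_int - {\<lambda>k. 0} \<noteq> {}" by blast
  then have "Delta_real x > 0 \<longleftrightarrow> separated_by_sampling x PW ell2_int"
    unfolding Delta_real_def
    by (intro projection_defect_pos_iff_separated[OF x]) (auto simp: ell2_int_def)
  also have "\<dots> \<longleftrightarrow> separated_by_sampling x PW_real ell2_int"
  proof -
    have "\<delta> \<le> ell2_norm (\<lambda>k. n k - sample x f k)"
      if n: "n \<in> ell2_int" and f: "f \<in> PW" and le: "\<forall>g\<in>PW_real. \<delta> \<le> ell2_norm (\<lambda>k. n k - sample x g k)" for \<delta> n f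
    proof -
      have n2: "n \<in> ell2" using n by (simp add: ell2_int_def)
      have sf: "sample x f \<in> ell2" using sampling_set_bounds[OF x] f by metis
      have "\<delta> \<le> ell2_norm (\<lambda>k. n k - sample x (\<lambda>t. complex_of_real (Re (f t))) k)"
        using le PW_Re_in_PW_real[OF f] by blast
      also have "\<dots> \<le> ell2_norm (\<lambda>k. n k - sample x f k)"
      proof (rule ell2_norm_mono(2)[OF ell2_diff[OF n2 sf]])
        fix k
        have "n k \<in> \<int>" using n by (simp add: ell2_int_def)
        then obtain m where "n k = of_int m" by (auto elim: Ints_cases)
        then have "n k - complex_of_real (Re (f (x k))) = complex_of_real (Re (n k - f (x k)))"
          by (simp add: complex_eq_iff)
        then have "cmod (n k - complex_of_real (Re (f (x k)))) = \<bar>Re (n k - f (x k))\<bar>"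
          by (simp only: norm_of_real)
        then show "cmod (n k - sample x (\<lambda>t. complex_of_real (Re (f t))) k) \<le> cmod (n k - sample x f k)"
          unfolding sample_def using abs_Re_le_cmod[of "n k - f (x k)"] by linarith
      qed
      finally show ?thesis .
    qed
    then show ?thesis
      unfolding separated_by_sampling_def using PW_real_subset by fast
  qed
  finally show ?thesis .
qed

section \<open>Folding and the continuity of the left inverse\<close>

text \<open>
  The Gaussian integer whose double is removed by folding.
\<close>
definition folding_integer :: "complex \<Rightarrow> complex" where
  "folding_integer z = Complex (of_int \<lfloor>(Re z + 1) / 2\<rfloor>) (of_int \<lfloor>(Im z + 1) / 2\<rfloor>)"

lemma fold_complex_eq: "fold_complex z = z - 2 * folding_integer z"
  by (simp add: fold_complex_def fold_real_eq folding_integer_def complex_eq_iff)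

lemma fold_complex_diff_even_gauss_int:
  assumes "Re n \<in> \<int>" "Im n \<in> \<int>"
  shows "fold_complex (z - 2 * n) = fold_complex z"
proof -
  obtain i j where ij: "Re n = of_int i" "Im n = of_int j"
    using assms by (auto elim!: Ints_cases)
  have "fold_real (s - 2 * of_int m) = fold_real s" for s and m :: int
  proof -
    have "(s - 2 * of_int m + 1) / 2 = (s + 1) / 2 - of_int m" by (simp add: field_simps)
    then have "\<lfloor>(s - 2 * of_int m + 1) / 2\<rfloor> = \<lfloor>(s + 1) / 2\<rfloor> - m" by (simp only: floor_diff_of_int)
    then show ?thesis unfolding fold_real_eq by simp
  qed
  then show ?thesis using ij by (simp add: fold_complex_def)
qed

lemma folding_integer_real: "z \<in> \<real> \<Longrightarrow> folding_integer z \<in> \<int>"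
proof -
  assume "z \<in> \<real>"
  then have "folding_integer z = of_int \<lfloor>(Re z + 1) / 2\<rfloor>"
    by (simp add: folding_integer_def complex_is_Real_iff complex_eq_iff)
  then show ?thesis by simp
qed

lemma gauss_int_nonzero_cmod:
  assumes "Re n \<in> \<int>" "Im n \<in> \<int>" "n \<noteq> 0"
  shows "1 \<le> cmod n"
proof -
  have "Re n \<noteq> 0 \<or> Im n \<noteq> 0" using assms(3) by (simp add: complex_eq_iff)
  then show ?thesis
  proof
    assume "Re n \<noteq> 0"
    then have "1 \<le> \<bar>Re n\<bar>" using Ints_nonzero_abs_ge1[OF assms(1)] by simp
    then show ?thesis using abs_Re_le_cmod[of n] by linarith
  next
    assume "Im n \<noteq> 0"
    then have "1 \<le> \<bar>Im n\<bar>" using Ints_nonzero_abs_ge1[OF assms(2)] by simp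
    then show ?thesis using abs_Im_le_cmod[of n] by linarith
  qed
qed

text \<open>
  Integer sequences cannot be small without vanishing. This is what is contradicted when samples of
  small signals come close to them.
\<close>
lemma gauss_int_sequence_norm_ge_1:
  assumes "n \<in> ell2_gauss_int" "n \<noteq> (\<lambda>k. 0)"
  shows "1 \<le> ell2_norm n"
proof -
  obtain k where "n k \<noteq> 0" using assms(2) by auto
  then have "1 \<le> cmod (n k)" using assms(1) by (intro gauss_int_nonzero_cmod) (auto simp: ell2_gauss_int_def)
  also have "\<dots> \<le> ell2_norm n" using assms(1) by (intro cmod_le_ell2_norm) (simp add: ell2_gauss_int_def)
  finally show ?thesis .
qed

lemma continuous_map_mtopology_of_iff:
  "continuous_map (mtopology_of m1) (mtopology_of m2) f \<longleftrightarrow> f ` mspace m1 \<subseteq> mspace m2 \<and>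
     (\<forall>a \<in> mspace m1. \<forall>\<epsilon>>0. \<exists>\<delta>>0. \<forall>y. y \<in> mspace m1 \<and> mdist m1 a y < \<delta> \<longrightarrow> mdist m2 (f a) (f y) < \<epsilon>)"
  unfolding mtopology_of_def
  by (rule Metric_space.metric_continuous_map[OF Metric_space_mspace_mdist Metric_space_mspace_mdist])

text \<open>
  \<open>V\<close> is the signal space. Folding removes twice an integer sequence from the samples of a signal, and
  \<open>L\<close> contains the differences of these integer sequences for two signals from \<open>V\<close>. Scaling by real
  numbers suffices to halve and double signals, and \<^const>\<open>PW_real\<close> is closed under it.
\<close>
locale folded_sampling =
  fixes x :: "int \<Rightarrow> real" and V :: "(real \<Rightarrow> complex) set" and L :: "(int \<Rightarrow> complex) set"
  assumes sampling: "sampling_set x" and V_PW: "V \<subseteq> PW" and L_gauss_int: "L \<subseteq> ell2_gauss_int"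
    and V_zero: "(\<lambda>t. 0) \<in> V"
    and V_diff: "\<And>f g. f \<in> V \<Longrightarrow> g \<in> V \<Longrightarrow> (\<lambda>t. f t - g t) \<in> V"
    and V_scale: "\<And>c f. f \<in> V \<Longrightarrow> (\<lambda>t. complex_of_real c * f t) \<in> V"
    and folding_integer_diff: "\<And>f g. f \<in> V \<Longrightarrow> g \<in> V \<Longrightarrow>
      (\<lambda>k. folding_integer (f (x k)) - folding_integer (g (x k))) \<in> ell2 \<Longrightarrow>
      (\<lambda>k. folding_integer (f (x k)) - folding_integer (g (x k))) \<in> L"
begin

lemma mspace_range [simp]: "mspace (folded_range_metric x V) = folded_sample x ` V"
  by (rule mspace_folded_range_metric[OF sampling V_PW])

lemma mspace_target [simp]: "mspace (submetric PW_metric V) = V"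
  using V_PW by auto

lemma sample_in_ell2: "f \<in> V \<Longrightarrow> sample x f \<in> ell2"
  using sampling_set_bounds[OF sampling] V_PW by (metis subsetD)

lemma folding_integer_in_ell2:
  assumes "f \<in> V" shows "(\<lambda>k. folding_integer (f (x k))) \<in> ell2"
proof -
  have "(\<lambda>k. 1 / 2 * (sample x f k - folded_sample x f k)) \<in> ell2"
    by (intro ell2_cmult ell2_diff sample_in_ell2 folded_sample_in_ell2 assms)
  then show ?thesis by (simp add: sample_def folded_sample_def fold_complex_eq)
qed

text \<open>
  A folded distance below \<open>2 * \<delta>\<close> is only possible if \<open>f\<close> and \<open>g\<close> are folded by the same integers. Then
  the lower sampling bound applies to \<open>f - g\<close>.
\<close>
lemma left_inverse_uniformly_continuous:
  assumes sep: "separated_by_sampling x V L" and T: "\<And>f. f \<in> V \<Longrightarrow> T (folded_sample x f) = f"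
  shows "uniformly_continuous_map (folded_range_metric x V) (submetric PW_metric V) T"
proof -
  obtain A B where A: "0 < A" and lower: "\<And>f. f \<in> PW \<Longrightarrow> A * L2_norm f \<le> ell2_norm (sample x f)"
    using sampling_set_bounds[OF sampling] by metis
  obtain \<delta> where \<delta>: "\<delta> > 0"
    and sep_le: "\<And>n f. n \<in> L \<Longrightarrow> n \<noteq> (\<lambda>k. 0) \<Longrightarrow> f \<in> V \<Longrightarrow> \<delta> \<le> ell2_norm (\<lambda>k. n k - sample x f k)"
    using sep unfolding separated_by_sampling_def by blast
  have close: "L2_norm (\<lambda>t. f t - g t) < \<epsilon>"
    if f: "f \<in> V" and g: "g \<in> V"
      and lt: "ell2_norm (\<lambda>k. folded_sample x f k - folded_sample x g k) < min (2 * \<delta>) (A * \<epsilon>)" for f g \<epsilon>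
  proof -
    define n where "n = (\<lambda>k. folding_integer (f (x k)) - folding_integer (g (x k)))"
    \<comment> \<open>\<open>h\<close> halves the difference because folding subtracts twice an integer.\<close>
    define h where "h = (\<lambda>t. complex_of_real (1 / 2) * (f t - g t))"
    have h: "h \<in> V" unfolding h_def by (intro V_scale V_diff f g)
    have n: "n \<in> L"
      unfolding n_def by (intro folding_integer_diff f g ell2_diff folding_integer_in_ell2)
    have "(\<lambda>k. folded_sample x f k - folded_sample x g k) = (\<lambda>k. (- 2) * (n k - sample x h k))"
      by (simp add: folded_sample_def sample_def fold_complex_eq n_def h_def fun_eq_iff)
    moreover have "(\<lambda>k. n k - sample x h k) \<in> ell2"
      using n L_gauss_int h by (intro ell2_diff sample_in_ell2) (auto simp: ell2_gauss_int_def)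
    ultimately have "ell2_norm (\<lambda>k. folded_sample x f k - folded_sample x g k) = 2 * ell2_norm (\<lambda>k. n k - sample x h k)"
      using ell2_cmult(2)[of "\<lambda>k. n k - sample x h k" "- 2"] by simp
    then have "ell2_norm (\<lambda>k. n k - sample x h k) < \<delta>" using lt by simp
    then have "n = (\<lambda>k. 0)" using sep_le[OF n _ h] by (meson not_le)
    then have "(\<lambda>k. folded_sample x f k - folded_sample x g k) = sample x (\<lambda>t. f t - g t)"
      by (simp add: folded_sample_def sample_def fold_complex_eq n_def fun_eq_iff)
    then have "A * L2_norm (\<lambda>t. f t - g t) < A * \<epsilon>"
      using lower[OF subsetD[OF V_PW V_diff[OF f g]]] lt by simp
    then show ?thesis using A by simp
  qed
  show ?thesis
    unfolding uniformly_continuous_map_def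
  proof (intro conjI allI impI)
    show "T \<in> mspace (folded_range_metric x V) \<rightarrow> mspace (submetric PW_metric V)"
      using T V_PW by auto
    fix \<epsilon> :: real assume "\<epsilon> > 0"
    then have "min (2 * \<delta>) (A * \<epsilon>) > 0" using A \<delta> by simp
    moreover have "mdist (submetric PW_metric V) (T b) (T a) < \<epsilon>"
      if "a \<in> folded_sample x ` V" "b \<in> folded_sample x ` V" "ell2_norm (\<lambda>k. b k - a k) < min (2 * \<delta>) (A * \<epsilon>)" for a b
      using that close T by auto
    ultimately show "\<exists>\<delta>>0. \<forall>a\<in>mspace (folded_range_metric x V). \<forall>b\<in>mspace (folded_range_metric x V).
        mdist (folded_range_metric x V) b a < \<delta> \<longrightarrow> mdist (submetric PW_metric V) (T b) (T a) < \<epsilon>"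
      by (intro exI[of _ "min (2 * \<delta>) (A * \<epsilon>)"]) simp
  qed
qed

text \<open>
  Continuity at the folded samples of the zero signal suffices. If \<open>C f\<close> is close to \<open>n\<close>, then the
  folded samples of \<open>2 f\<close> are small, so \<open>f\<close> is small. But \<open>C f\<close>, being close to \<open>n\<close>, is not.
\<close>
lemma separated_if_left_inverse_continuous:
  assumes T: "\<And>f. f \<in> V \<Longrightarrow> T (folded_sample x f) = f"
    and cont: "continuous_map (mtopology_of (folded_range_metric x V)) (mtopology_of (submetric PW_metric V)) T"
  shows "separated_by_sampling x V L"
proof -
  obtain B where B: "0 < B" and upper: "\<And>f. f \<in> PW \<Longrightarrow> ell2_norm (sample x f) \<le> B * L2_norm f"
    using sampling_set_bounds[OF sampling] by metis
  have "folded_sample x (\<lambda>t. 0) \<in> mspace (folded_range_metric x V)" using V_zero by simp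
  \<comment> \<open>With \<open>L2_norm (2 f) < 1 / B\<close> the samples of \<open>f\<close> have norm below 1/2. So \<open>n\<close>, at distance below 1/2 from them, would have norm below 1.\<close>
  moreover have "1 / B > 0" using B by simp
  ultimately have "\<exists>\<delta>>0. \<forall>y. y \<in> mspace (folded_range_metric x V) \<and>
      mdist (folded_range_metric x V) (folded_sample x (\<lambda>t. 0)) y < \<delta> \<longrightarrow>
      mdist (submetric PW_metric V) (T (folded_sample x (\<lambda>t. 0))) (T y) < 1 / B"
    using cont unfolding continuous_map_mtopology_of_iff by blast
  then obtain \<delta> where \<delta>: "\<delta> > 0"
    and near: "\<And>y. y \<in> folded_sample x ` V \<Longrightarrow> ell2_norm (\<lambda>k. folded_sample x (\<lambda>t. 0) k - y k) < \<delta> \<Longrightarrow>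
      L2_norm (\<lambda>t. T (folded_sample x (\<lambda>t. 0)) t - T y t) < 1 / B"
    by auto
  have fold0: "folded_sample x (\<lambda>t. 0) = (\<lambda>k. 0)"
    by (auto simp: folded_sample_def fold_complex_eq folding_integer_def complex_eq_iff fun_eq_iff)
  have small: "L2_norm f < 1 / B" if f: "f \<in> V" and lt: "ell2_norm (folded_sample x f) < \<delta>" for f
  proof -
    have "L2_norm (\<lambda>t. 0 - f t) < 1 / B"
      using near[of "folded_sample x f"] f lt T[OF V_zero] T[OF f]
      by (simp add: fold0 ell2_norm_def)
    then show ?thesis by (simp add: L2_norm_def)
  qed
  have "min (\<delta> / 2) (1 / 2) \<le> ell2_norm (\<lambda>k. n k - sample x f k)"
    if n: "n \<in> L" "n \<noteq> (\<lambda>k. 0)" and f: "f \<in> V" for n f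
  proof (rule ccontr)
    assume "\<not> min (\<delta> / 2) (1 / 2) \<le> ell2_norm (\<lambda>k. n k - sample x f k)"
    then have lt: "ell2_norm (\<lambda>k. n k - sample x f k) < \<delta> / 2" "ell2_norm (\<lambda>k. n k - sample x f k) < 1 / 2"
      by auto
    have n_gauss: "n \<in> ell2_gauss_int" using n L_gauss_int by blast
    have nf: "(\<lambda>k. n k - sample x f k) \<in> ell2"
      using n_gauss f by (intro ell2_diff sample_in_ell2) (auto simp: ell2_gauss_int_def)
    define h where "h = (\<lambda>t. complex_of_real 2 * f t)"
    have h: "h \<in> V" unfolding h_def by (rule V_scale[OF f])
    have "ell2_norm (folded_sample x h) \<le> ell2_norm (\<lambda>k. (- 2) * (n k - sample x f k))"
    proof (rule ell2_norm_mono(2)[OF ell2_cmult(1)[OF nf]])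
      fix k
      have "folded_sample x h k = fold_complex (2 * f (x k) - 2 * n k)"
        using n_gauss by (subst fold_complex_diff_even_gauss_int) (auto simp: folded_sample_def h_def ell2_gauss_int_def)
      also have "2 * f (x k) - 2 * n k = (- 2) * (n k - sample x f k)" by (simp add: sample_def)
      finally show "cmod (folded_sample x h k) \<le> cmod ((- 2) * (n k - sample x f k))"
        using cmod_fold_complex_le by simp
    qed
    also have "\<dots> = 2 * ell2_norm (\<lambda>k. n k - sample x f k)"
      by (simp only: ell2_cmult(2)[OF nf]) simp
    finally have "L2_norm h < 1 / B" using lt by (intro small[OF h]) linarith
    moreover have "L2_norm h = 2 * L2_norm f"
      using square_integrable_cmult(2)[OF PW_square_integrable, of f 2] f V_PW by (auto simp: h_def)
    ultimately have "B * L2_norm f < 1 / 2" using B by (simp add: field_simps)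
    then have "ell2_norm (sample x f) < 1 / 2" using upper[OF subsetD[OF V_PW f]] by linarith
    moreover have "ell2_norm n \<le> ell2_norm (\<lambda>k. n k - sample x f k) + ell2_norm (sample x f)"
      using ell2_add(2)[OF nf sample_in_ell2[OF f]] by simp
    moreover have "1 \<le> ell2_norm n" by (rule gauss_int_sequence_norm_ge_1[OF n_gauss n(2)])
    ultimately show False using lt by linarith
  qed
  then show ?thesis
    unfolding separated_by_sampling_def using \<delta> by (intro exI[of _ "min (\<delta> / 2) (1 / 2)"]) auto
qed

lemma left_inverse_continuity_iff_separated:
  assumes T: "\<And>f. f \<in> V \<Longrightarrow> T (folded_sample x f) = f"
  shows "continuous_map (mtopology_of (folded_range_metric x V)) (mtopology_of (submetric PW_metric V)) T
      \<longleftrightarrow> separated_by_sampling x V L"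
    and "uniformly_continuous_map (folded_range_metric x V) (submetric PW_metric V) T
      \<longleftrightarrow> separated_by_sampling x V L"
proof -
  let ?C = "continuous_map (mtopology_of (folded_range_metric x V)) (mtopology_of (submetric PW_metric V)) T"
  let ?U = "uniformly_continuous_map (folded_range_metric x V) (submetric PW_metric V) T"
  have "separated_by_sampling x V L \<Longrightarrow> ?U"
    by (rule left_inverse_uniformly_continuous[OF _ T])
  moreover have "?U \<Longrightarrow> ?C"
    by (rule uniformly_continuous_imp_continuous_map)
  moreover have "?C \<Longrightarrow> separated_by_sampling x V L"
    by (rule separated_if_left_inverse_continuous[OF T])
  ultimately show "?C \<longleftrightarrow> separated_by_sampling x V L" "?U \<longleftrightarrow> separated_by_sampling x V L"
    by blast+
qed

end

lemma PW_folded_sampling: "sampling_set x \<Longrightarrow> folded_sampling x PW ell2_gauss_int"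
  by unfold_locales
    (auto simp: zero_in_PW ell2_gauss_int_def folding_integer_def intro: PW_diff PW_cmult)

lemma PW_real_folded_sampling:
  assumes "sampling_set x" shows "folded_sampling x PW_real ell2_int"
proof
  show "(\<lambda>t. 0) \<in> PW_real" by (simp add: PW_real_def zero_in_PW)
  show "ell2_int \<subseteq> ell2_gauss_int"
  proof
    fix n assume n: "n \<in> ell2_int"
    have "Re (n k) \<in> \<int> \<and> Im (n k) \<in> \<int>" for k
    proof -
      have "n k \<in> \<int>" using n by (simp add: ell2_int_def)
      then obtain m where "n k = of_int m" by (auto elim: Ints_cases)
      then show ?thesis by simp
    qed
    then show "n \<in> ell2_gauss_int" using n by (simp add: ell2_int_def ell2_gauss_int_def)
  qed
  fix f g assume f: "f \<in> PW_real" and g: "g \<in> PW_real"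
  show "(\<lambda>t. f t - g t) \<in> PW_real"
    unfolding PW_real_def using f g PW_real_subset
    by (intro CollectI conjI PW_diff AE_I2 Reals_diff PW_real_value_real) auto
  show "(\<lambda>t. complex_of_real c * f t) \<in> PW_real" for c
    unfolding PW_real_def using f PW_real_subset
    by (intro CollectI conjI PW_cmult AE_I2 Reals_mult Reals_of_real PW_real_value_real) auto
  assume "(\<lambda>k. folding_integer (f (x k)) - folding_integer (g (x k))) \<in> ell2"
  then show "(\<lambda>k. folding_integer (f (x k)) - folding_integer (g (x k))) \<in> ell2_int"
    using f g by (auto simp: ell2_int_def intro!: Ints_diff folding_integer_real PW_real_value_real)
qed (use assms PW_real_subset in auto)

theorem proposition4p6:
  fixes x :: "int \<Rightarrow> real"
  assumes "sampling_set x"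
  shows "(\<forall>T :: (int \<Rightarrow> complex) \<Rightarrow> (real \<Rightarrow> complex).
            (\<forall>f\<in>PW. T (folded_sample x f) = f) \<longrightarrow>
              (continuous_map (mtopology_of (folded_range_metric x PW)) (mtopology_of PW_metric) T
                 \<longleftrightarrow> Delta x > 0) \<and>
              (uniformly_continuous_map (folded_range_metric x PW) PW_metric T
                 \<longleftrightarrow> Delta x > 0)) \<and>
         (\<forall>T :: (int \<Rightarrow> complex) \<Rightarrow> (real \<Rightarrow> complex).
            (\<forall>f\<in>PW_real. T (folded_sample x f) = f) \<longrightarrow>
              (continuous_map (mtopology_of (folded_range_metric x PW_real))
                   (mtopology_of (submetric PW_metric PW_real)) T
                 \<longleftrightarrow> Delta_real x > 0) \<and>
              (uniformly_continuous_map (folded_range_metric x PW_real)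
                   (submetric PW_metric PW_real) T
                 \<longleftrightarrow> Delta_real x > 0))"
proof -
  have "submetric PW_metric PW = PW_metric"
    using submetric_mspace[of PW_metric] by simp
  then show ?thesis
    using folded_sampling.left_inverse_continuity_iff_separated[OF PW_folded_sampling[OF assms]]
      folded_sampling.left_inverse_continuity_iff_separated[OF PW_real_folded_sampling[OF assms]]
    by (simp add: Delta_pos_iff[OF assms] Delta_real_pos_iff[OF assms])
qed

end
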